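(* Let $n\ge 1$ and let $A,B$ be symmetric skew braces. Then $A$ and $B$ are $n$-isoclinic if and only if there exist skew braces $C$, $N_1$, $N_2$, $C_A$ and $C_B$ (with $N_1,N_2$ ideals of $C$) such that $A\cong C/N_2$ and $B\cong C/N_1$ and the following two equivalent conditions hold: (1) $C$ is $n$-isoclinic to both $A$ and $B$. (2) $C_B\cong C\cong C_A$, and $C$ is $n$-isoclinic to both $C/N_2\times C/\Gamma_{n+1}(C)$ and $C/N_1\times C/\Gamma_{n+1}(C)$, where $C_B$ and $C_A$ are sub-skew braces of $C/N_2\times C/\Gamma_{n+1}(C)$ and $C/N_1\times C/\Gamma_{n+1}(C)$ respectively.
   Context: A skew (left) brace is a set $A$ with two group structures $(A,\cdot)$, $(A,\circ)$ such that $a\circ(b\cdot c)=(a\circ b)\cdot a^{-1}\cdot(a\circ c)$ for all $a,b,c$, where $a^{-1}$ is the inverse in $(A,\cdot)$. The two identities coincide, denoted $1$. It is symmetric if $(A,\circ,\cdot)$ is also a skew brace. Put $\lambda_a(b)=a^{-1}\cdot(a\circ b)$, $a*b=\lambda_a(b)\cdot b^{-1}$, $[a,b]^{\cdot}=a\cdot b\cdot a^{-1}\cdot b^{-1}$. Brace homomorphisms preserve both operations; a sub-skew brace is a subset that is a subgroup of both groups. An ideal is a subgroup of $(A,\cdot)$ stable under all $\lambda_a$ and normal in both groups. Products are direct products; $\cong$ is brace isomorphism. Annihilator series: $\mathrm{Ann}_0(A)=1$, $\mathrm{Ann}(A)=\mathrm{Ann}_1(A)=\{a: a*b=b*a=[a,b]^{\cdot}=1\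 \forall b\in A\}$, $\mathrm{Ann}_n(A)/\mathrm{Ann}_{n-1}(A)=\mathrm{Ann}(A/\mathrm{Ann}_{n-1}(A))$; these are ideals. Lower central series: $\Gamma_1(A)=A$, and $\Gamma_n(A)$ is the subgroup of $(A,\cdot)$ generated by all $a*u$, $u*a$, $[a,u]^{\cdot}$ with $a\in A$, $u\in\Gamma_{n-1}(A)$; these are ideals. Commutator words: $M$ is the free monoid on the four symbols $X=\{\gamma,\bar\gamma,*,\bar *\}$, where $\gamma(a,b)=[a,b]^{\cdot}$, $\bar\gamma(a,b)=[b,a]^{\cdot}$, $*(a,b)=a*b$, $\bar *(a,b)=b*a$. For $m=\epsilon_1\cdots\epsilon_s\in M$ ($\epsilon_i\in X$), $\deg(m)=s$ and $m(a_1a_2\cdots a_{s+1})=\epsilon_1(a_1,\epsilon_2(a_2,\ldots,\epsilon_s(a_s,a_{s+1})\cdots))$. $A_{(t)}$ is the subgroup of $(A,\cdot)$ generated by all values $m(a_1\cdots a_{\deg(m)+1})$ with $m\in M$, $\deg(m)\ge t$, $a_i\in A$ (it is a sub-skew brace). $\mathcal I_n$ is the class of skew braces $A$ such that for every $m\in M$ with $\deg(m)=n$ the map $\phi^A_m:(A/\mathrm{Ann}_n(A))^{n+1}\to A_{(n)}$, $(\mathrm{Ann}_n(A)a_1,\ldots,\mathrm{Ann}_n(A)a_{n+1})\mapsto m(a_1\cdots a_{n+1})$, is well defined. Every symmetric skew brace lies in $\mathcal I_n$. Two skew braces $A,B\in\mathcal I_n$ are $n$-isoclinic if there are brace isomorphisms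 $\xi:A/\mathrm{Ann}_n(A)\to B/\mathrm{Ann}_n(B)$ and $\theta:A_{(n)}\to B_{(n)}$ with $\theta\circ\phi^A_m=\phi^B_m\circ\xi^{n+1}$ for all $m\in M$ with $\deg(m)=n$, where $\xi^{n+1}=\xi\times\cdots\times\xi$ ($n+1$ copies).
   Formalization: "Equivalent" is read as: existence of such C, N1, N2 with (1), and existence of such data with (2), each characterize n-isoclinism; for fixed C, N1, N2 only that (2) implies (1) is claimed, since (1) can hold without (2) for infinite groups. *)

theory Defs
  imports "HOL-Algebra.Generated_Groups"
begin

(* The multiplicative part of the record is the group written (A,.) on paper. The two identities
   of a skew brace coincide, so a single field for the identity serves both groups. *)
record 'a brace = "'a monoid" +
  circ :: "'a \<Rightarrow> 'a \<Rightarrow> 'a"  (infixl \<open>\<odot>\<index>\<close> 70)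

(* Exchanges the two operations; its multiplicative part is the group (A,o). *)
definition swap :: "'a brace \<Rightarrow> 'a brace" where
  "swap A = \<lparr>carrier = carrier A, mult = circ A, one = \<one>\<^bsub>A\<^esub>, circ = mult A\<rparr>"

definition skew_brace :: "'a brace \<Rightarrow> bool" where
  "skew_brace A \<longleftrightarrow> group A \<and> group (swap A) \<and>
    (\<forall>a \<in> carrier A. \<forall>b \<in> carrier A. \<forall>c \<in> carrier A.
      a \<odot>\<^bsub>A\<^esub> (b \<otimes>\<^bsub>A\<^esub> c) = (a \<odot>\<^bsub>A\<^esub> b) \<otimes>\<^bsub>A\<^esub> inv\<^bsub>A\<^esub> a \<otimes>\<^bsub>A\<^esub> (a \<odot>\<^bsub>A\<^esub> c))"

definition symmetric_skew_brace :: "'a brace \<Rightarrow> bool" where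
  "symmetric_skew_brace A \<longleftrightarrow> skew_brace A \<and> skew_brace (swap A)"

definition lam :: "'a brace \<Rightarrow> 'a \<Rightarrow> 'a \<Rightarrow> 'a" where
  "lam A a b = inv\<^bsub>A\<^esub> a \<otimes>\<^bsub>A\<^esub> (a \<odot>\<^bsub>A\<^esub> b)"

definition star :: "'a brace \<Rightarrow> 'a \<Rightarrow> 'a \<Rightarrow> 'a" where
  "star A a b = lam A a b \<otimes>\<^bsub>A\<^esub> inv\<^bsub>A\<^esub> b"

definition commutator :: "'a brace \<Rightarrow> 'a \<Rightarrow> 'a \<Rightarrow> 'a" where
  "commutator A a b = a \<otimes>\<^bsub>A\<^esub> b \<otimes>\<^bsub>A\<^esub> inv\<^bsub>A\<^esub> a \<otimes>\<^bsub>A\<^esub> inv\<^bsub>A\<^esub> b"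

definition brace_hom :: "'a brace \<Rightarrow> 'b brace \<Rightarrow> ('a \<Rightarrow> 'b) set" where
  "brace_hom A B = hom A B \<inter> hom (swap A) (swap B)"

definition brace_iso :: "'a brace \<Rightarrow> 'b brace \<Rightarrow> ('a \<Rightarrow> 'b) set" where
  "brace_iso A B = {h \<in> brace_hom A B. bij_betw h (carrier A) (carrier B)}"

definition brace_isomorphic :: "'a brace \<Rightarrow> 'b brace \<Rightarrow> bool"  (infix \<open>\<cong>\<^sub>b\<close> 60) where
  "A \<cong>\<^sub>b B \<longleftrightarrow> brace_iso A B \<noteq> {}"

definition sub_skew_brace :: "'a set \<Rightarrow> 'a brace \<Rightarrow> bool" where
  "sub_skew_brace H A \<longleftrightarrow> subgroup H A \<and> subgroup H (swap A)"

definition restrict_brace :: "'a brace \<Rightarrow> 'a set \<Rightarrow> 'a brace" where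
  "restrict_brace A H = A\<lparr>carrier := H\<rparr>"

definition brace_ideal :: "'a set \<Rightarrow> 'a brace \<Rightarrow> bool" where
  "brace_ideal I A \<longleftrightarrow> I \<lhd> A \<and> I \<lhd> swap A \<and> (\<forall>a \<in> carrier A. lam A a ` I \<subseteq> I)"

(* For an ideal I the cosets of I in the two groups are the same sets, so the elementwise product
   of two cosets with respect to either operation is again a coset. *)
definition quotient_brace :: "'a brace \<Rightarrow> 'a set \<Rightarrow> 'a set brace" where
  "quotient_brace A I =
    \<lparr>carrier = rcosets\<^bsub>A\<^esub> I, mult = set_mult A, one = I, circ = set_mult (swap A)\<rparr>"

definition prod_brace :: "'a brace \<Rightarrow> 'b brace \<Rightarrow> ('a \<times> 'b) brace" where
  "prod_brace A B =
    \<lparr>carrier = carrier A \<times> carrier B,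
     mult = (\<lambda>(a, b) (a', b'). (a \<otimes>\<^bsub>A\<^esub> a', b \<otimes>\<^bsub>B\<^esub> b')),
     one = (\<one>\<^bsub>A\<^esub>, \<one>\<^bsub>B\<^esub>),
     circ = (\<lambda>(a, b) (a', b'). (a \<odot>\<^bsub>A\<^esub> a', b \<odot>\<^bsub>B\<^esub> b'))\<rparr>"

definition Ann :: "'a brace \<Rightarrow> 'a set" where
  "Ann A = {a \<in> carrier A. \<forall>b \<in> carrier A.
     star A a b = \<one>\<^bsub>A\<^esub> \<and> star A b a = \<one>\<^bsub>A\<^esub> \<and> commutator A a b = \<one>\<^bsub>A\<^esub>}"

(* The step takes the full preimage of the annihilator under the projection A -> A/Ann_n(A). *)
primrec upper_ann :: "'a brace \<Rightarrow> nat \<Rightarrow> 'a set" where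
  "upper_ann A 0 = {\<one>\<^bsub>A\<^esub>}"
| "upper_ann A (Suc n) =
    {a \<in> carrier A. upper_ann A n #>\<^bsub>A\<^esub> a \<in> Ann (quotient_brace A (upper_ann A n))}"

(* The series starts at index 1; the value at 0 is a dummy. *)
fun lower_central :: "'a brace \<Rightarrow> nat \<Rightarrow> 'a set" where
  "lower_central A 0 = carrier A"
| "lower_central A (Suc 0) = carrier A"
| "lower_central A (Suc (Suc n)) = generate A
    (\<Union>a \<in> carrier A. \<Union>u \<in> lower_central A (Suc n). {star A a u, star A u a, commutator A a u})"

datatype symb = Gam | GamBar | Star | StarBar

fun apply_symb :: "'a brace \<Rightarrow> symb \<Rightarrow> 'a \<Rightarrow> 'a \<Rightarrow> 'a" where
  "apply_symb A Gam a b = commutator A a b"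
| "apply_symb A GamBar a b = commutator A b a"
| "apply_symb A Star a b = star A a b"
| "apply_symb A StarBar a b = star A b a"

(* The free monoid on the symbols is symb list, the degree being the length. A word of degree s
   is evaluated at lists of s + 1 elements; other argument lists give an unspecified value. *)
fun word_val :: "'a brace \<Rightarrow> symb list \<Rightarrow> 'a list \<Rightarrow> 'a" where
  "word_val A [] [a] = a"
| "word_val A (e # m) (a # as) = apply_symb A e a (word_val A m as)"
| "word_val A _ _ = undefined"

definition tuples :: "'a brace \<Rightarrow> nat \<Rightarrow> 'a list set" where
  "tuples A k = {as. length as = k \<and> set as \<subseteq> carrier A}"

definition verbal :: "'a brace \<Rightarrow> nat \<Rightarrow> 'a set" where
  "verbal A t = generate A
    {word_val A m as | m as. length m \<ge> t \<and> as \<in> tuples A (length m + 1)}"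

abbreviation quot_ann :: "'a brace \<Rightarrow> nat \<Rightarrow> 'a set brace" where
  "quot_ann A n \<equiv> quotient_brace A (upper_ann A n)"

definition coset_tuple :: "'a brace \<Rightarrow> nat \<Rightarrow> 'a list \<Rightarrow> 'a set list" where
  "coset_tuple A n as = map (\<lambda>a. upper_ann A n #>\<^bsub>A\<^esub> a) as"

definition phi_well_defined :: "'a brace \<Rightarrow> nat \<Rightarrow> symb list \<Rightarrow> bool" where
  "phi_well_defined A n m \<longleftrightarrow>
    (\<forall>as \<in> tuples A (n + 1). \<forall>bs \<in> tuples A (n + 1).
      coset_tuple A n as = coset_tuple A n bs \<longrightarrow> word_val A m as = word_val A m bs)"

(* Meaningful for words m of degree n with phi_well_defined A n m. *)
definition phi :: "'a brace \<Rightarrow> nat \<Rightarrow> symb list \<Rightarrow> 'a set list \<Rightarrow> 'a" where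
  "phi A n m Xs = (THE x. \<exists>as \<in> tuples A (n + 1). coset_tuple A n as = Xs \<and> x = word_val A m as)"

definition in_class_I :: "nat \<Rightarrow> 'a brace \<Rightarrow> bool" where
  "in_class_I n A \<longleftrightarrow> skew_brace A \<and> (\<forall>m. length m = n \<longrightarrow> phi_well_defined A n m)"

definition isoclinic :: "nat \<Rightarrow> 'a brace \<Rightarrow> 'b brace \<Rightarrow> bool" where
  "isoclinic n A B \<longleftrightarrow> in_class_I n A \<and> in_class_I n B \<and>
    (\<exists>\<xi> \<in> brace_iso (quot_ann A n) (quot_ann B n).
     \<exists>\<theta> \<in> brace_iso (restrict_brace A (verbal A n)) (restrict_brace B (verbal B n)).
       \<forall>m. length m = n \<longrightarrow>
         (\<forall>Xs \<in> tuples (quot_ann A n) (n + 1). \<theta> (phi A n m Xs) = phi B n m (map \<xi> Xs)))"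

definition common_cover :: "'a brace \<Rightarrow> 'b brace \<Rightarrow> 'c brace \<Rightarrow> 'c set \<Rightarrow> 'c set \<Rightarrow> bool" where
  "common_cover A B C N\<^sub>1 N\<^sub>2 \<longleftrightarrow>
    skew_brace C \<and> brace_ideal N\<^sub>1 C \<and> brace_ideal N\<^sub>2 C \<and>
    A \<cong>\<^sub>b quotient_brace C N\<^sub>2 \<and> B \<cong>\<^sub>b quotient_brace C N\<^sub>1"

definition isoclinic_to_both :: "nat \<Rightarrow> 'a brace \<Rightarrow> 'b brace \<Rightarrow> 'c brace \<Rightarrow> bool" where
  "isoclinic_to_both n A B C \<longleftrightarrow> isoclinic n C A \<and> isoclinic n C B"

abbreviation prod_quot :: "nat \<Rightarrow> 'c brace \<Rightarrow> 'c set \<Rightarrow> ('c set \<times> 'c set) brace" where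
  "prod_quot n C N \<equiv>
    prod_brace (quotient_brace C N) (quotient_brace C (lower_central C (n + 1)))"

definition isoclinic_to_products ::
    "nat \<Rightarrow> 'c brace \<Rightarrow> 'c set \<Rightarrow> 'c set \<Rightarrow> ('c set \<times> 'c set) set \<Rightarrow> ('c set \<times> 'c set) set \<Rightarrow> bool"
  where
  "isoclinic_to_products n C N\<^sub>1 N\<^sub>2 C\<^sub>A C\<^sub>B \<longleftrightarrow>
    sub_skew_brace C\<^sub>B (prod_quot n C N\<^sub>2) \<and> sub_skew_brace C\<^sub>A (prod_quot n C N\<^sub>1) \<and>
    restrict_brace (prod_quot n C N\<^sub>2) C\<^sub>B \<cong>\<^sub>b C \<and> C \<cong>\<^sub>b restrict_brace (prod_quot n C N\<^sub>1) C\<^sub>A \<and>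
    isoclinic n C (prod_quot n C N\<^sub>2) \<and> isoclinic n C (prod_quot n C N\<^sub>1)"

end

theory Submission
  imports Defs
begin

text \<open>
  Everything rests on one way of producing isoclinisms: a surjective brace homomorphism
  \<open>f : C \<rightarrow> A\<close> whose kernel meets \<open>C\<^sub>(\<^sub>n\<^sub>)\<close> trivially is an \<open>n\<close>-isoclinism
  (\<open>isoclinic_surjection\<close>). The reason is that an element lies in \<open>Ann\<^sub>n\<close> exactly when
  every word of degree \<open>n\<close> vanishes as soon as this element is its last argument
  (\<open>upper_ann_iff_words\<close>). The values concerned lie in \<open>C\<^sub>(\<^sub>n\<^sub>)\<close>, where \<open>f\<close> is
  injective, so \<open>Ann\<^sub>n(C)\<close> is the full preimage of \<open>Ann\<^sub>n(A)\<close>. Hence \<open>f\<close> induces both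
  the isomorphism of the quotients by \<open>Ann\<^sub>n\<close> and that of the verbal subgroups.

  Given an isoclinism \<open>(\<xi>,\<theta>)\<close> from \<open>A\<close> to \<open>B\<close>, the cover \<open>C\<close> consists of the pairs
  \<open>(a,b)\<close> for which \<open>\<xi>\<close> maps the coset of \<open>a\<close> to the coset of \<open>b\<close>
  (\<open>fibre_product\<close>). A word of degree \<open>n\<close> evaluated at such pairs has the value \<open>(x, \<theta>(x))\<close>, so \<open>C\<^sub>(\<^sub>n\<^sub>)\<close> lies in the graph of
  \<open>\<theta>\<close> and meets the kernels \<open>N\<^sub>2\<close> and \<open>N\<^sub>1\<close> of the two projections trivially. By the principle
  above, \<open>C\<close> is isoclinic to both \<open>A \<cong> C/N\<^sub>2\<close> and \<open>B \<cong> C/N\<^sub>1\<close>.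

  For a product \<open>C/N \<times> C/\<Gamma>\<^sub>n\<^sub>+\<^sub>1(C)\<close>, words of degree \<open>n\<close> vanish in the second factor,
  so the first projection is again such a surjection (\<open>isoclinic_prod_quot\<close>). Therefore
  being isoclinic to the product and being isoclinic to \<open>C/N\<close> are the same.
  The copy of \<open>C\<close> inside the product is the image of \<open>c \<mapsto> (cN, c\<Gamma>\<^sub>n\<^sub>+\<^sub>1)\<close>. This map is injective
  because \<open>\<Gamma>\<^sub>n\<^sub>+\<^sub>1(C)\<close> is contained in \<open>C\<^sub>(\<^sub>n\<^sub>)\<close> (\<open>lower_central_le_verbal\<close>). This inclusion is the point at
  which the symmetry of \<open>A\<close> and \<open>B\<close>, inherited by \<open>C\<close>, enters: in a symmetric brace \<open>\<lambda>\<close> is an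
  anti-homomorphism on \<open>(C,\<cdot>)\<close>, so that \<open>(u\<cdot>v) * a\<close> can be expressed by \<open>u * a\<close> and \<open>v * a\<close>.
  The converse directions follow because isoclinism is symmetric and transitive.
\<close>

section \<open>Skew braces and their ideals\<close>

lemma swap_simps [simp]:
  "carrier (swap A) = carrier A" "mult (swap A) = circ A" "\<one>\<^bsub>swap A\<^esub> = \<one>\<^bsub>A\<^esub>"
  "circ (swap A) = mult A"
  by (simp_all add: swap_def)

lemma (in group) cancel_left:
  assumes "x \<in> carrier G" "y \<in> carrier G"
  shows "x \<otimes> (inv x \<otimes> y) = y" "inv x \<otimes> (x \<otimes> y) = y"
  using assms by (simp_all flip: m_assoc)

lemma group_image:
  assumes "group G" "f \<in> hom G H" "carrier H = f ` carrier G" "\<one>\<^bsub>H\<^esub> = f \<one>\<^bsub>G\<^esub>"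
  shows "group H"
proof -
  have "H\<lparr>carrier := f ` carrier G, one := f \<one>\<^bsub>G\<^esub>\<rparr> = H"
    using assms(3,4) by simp
  with group.hom_imp_img_group[OF assms(1,2)] show ?thesis by simp
qed

locale skew_brace_ops =
  fixes A :: "'a brace" (structure)
  assumes skew_brace: "skew_brace A"

sublocale skew_brace_ops \<subseteq> group A
  using skew_brace by (simp add: skew_brace_def)

sublocale skew_brace_ops \<subseteq> circ: group "swap A"
  rewrites "carrier (swap A) = carrier A" and "mult (swap A) = circ A" and "\<one>\<^bsub>swap A\<^esub> = \<one>"
  using skew_brace by (simp_all add: skew_brace_def)

context skew_brace_ops
begin

lemmas group_simps = m_assoc inv_mult_group cancel_left

abbreviation cinv where "cinv x \<equiv> inv\<^bsub>swap A\<^esub> x"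

lemma brace_law:
  "\<lbrakk>a \<in> carrier A; b \<in> carrier A; c \<in> carrier A\<rbrakk> \<Longrightarrow>
    a \<odot> (b \<otimes> c) = (a \<odot> b) \<otimes> inv a \<otimes> (a \<odot> c)"
  using skew_brace by (simp add: skew_brace_def)

lemma lam_closed [simp]: "\<lbrakk>a \<in> carrier A; b \<in> carrier A\<rbrakk> \<Longrightarrow> lam A a b \<in> carrier A"
  by (simp add: lam_def)

lemma circ_eq_mult_lam: "\<lbrakk>a \<in> carrier A; b \<in> carrier A\<rbrakk> \<Longrightarrow> a \<odot> b = a \<otimes> lam A a b"
  by (simp add: lam_def cancel_left)

lemma lam_mult:
  "\<lbrakk>a \<in> carrier A; b \<in> carrier A; c \<in> carrier A\<rbrakk> \<Longrightarrow>
    lam A a (b \<otimes> c) = lam A a b \<otimes> lam A a c"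
  by (simp add: lam_def brace_law m_assoc)

lemma lam_one [simp]: "a \<in> carrier A \<Longrightarrow> lam A a \<one> = \<one>" "b \<in> carrier A \<Longrightarrow> lam A \<one> b = b"
  by (simp_all add: lam_def)

lemma lam_inv:
  assumes "a \<in> carrier A" "b \<in> carrier A"
  shows "lam A a (inv b) = inv (lam A a b)"
proof (rule inv_equality[symmetric])
  show "lam A a (inv b) \<otimes> lam A a b = \<one>"
    using assms by (simp flip: lam_mult)
qed (use assms in simp_all)

lemma lam_circ:
  assumes "a \<in> carrier A" "b \<in> carrier A" "c \<in> carrier A"
  shows "lam A (a \<odot> b) c = lam A a (lam A b c)"
proof -
  have "(a \<odot> b) \<otimes> lam A (a \<odot> b) c = a \<odot> (b \<odot> c)"
    using assms by (simp flip: circ_eq_mult_lam add: circ.m_assoc)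
  also have "\<dots> = (a \<odot> b) \<otimes> lam A a (lam A b c)"
    using assms by (simp add: circ_eq_mult_lam lam_mult m_assoc)
  finally show ?thesis using assms by simp
qed

lemma lam_cinv:
  assumes "a \<in> carrier A" "b \<in> carrier A"
  shows "lam A a (lam A (cinv a) b) = b" "lam A (cinv a) (lam A a b) = b"
  using assms by (simp_all flip: lam_circ)

lemma cinv_eq: "a \<in> carrier A \<Longrightarrow> cinv a = lam A (cinv a) (inv a)"
proof -
  assume a: "a \<in> carrier A"
  then have "cinv a \<otimes> lam A (cinv a) a = \<one>"
    by (simp flip: circ_eq_mult_lam)
  then show ?thesis
    using a by (simp add: lam_inv inv_equality)
qed

lemma mult_eq_circ_lam:
  "\<lbrakk>a \<in> carrier A; b \<in> carrier A\<rbrakk> \<Longrightarrow> a \<otimes> b = a \<odot> lam A (cinv a) b"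
  by (simp add: circ_eq_mult_lam lam_cinv)

lemma star_closed [simp]: "\<lbrakk>a \<in> carrier A; b \<in> carrier A\<rbrakk> \<Longrightarrow> star A a b \<in> carrier A"
  by (simp add: star_def)

lemma commutator_closed [simp]:
  "\<lbrakk>a \<in> carrier A; b \<in> carrier A\<rbrakk> \<Longrightarrow> commutator A a b \<in> carrier A"
  by (simp add: commutator_def)

lemma apply_symb_closed [simp]:
  "\<lbrakk>a \<in> carrier A; b \<in> carrier A\<rbrakk> \<Longrightarrow> apply_symb A e a b \<in> carrier A"
  by (cases e) simp_all

lemma lam_eq_star: "\<lbrakk>a \<in> carrier A; b \<in> carrier A\<rbrakk> \<Longrightarrow> lam A a b = star A a b \<otimes> b"
  by (simp add: star_def m_assoc)

lemma conj_eq_commutator: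
  "\<lbrakk>a \<in> carrier A; b \<in> carrier A\<rbrakk> \<Longrightarrow> a \<otimes> b \<otimes> inv a = commutator A a b \<otimes> b"
  by (simp add: commutator_def m_assoc)

lemma inv_commutator:
  "\<lbrakk>a \<in> carrier A; b \<in> carrier A\<rbrakk> \<Longrightarrow> inv (commutator A a b) = commutator A b a"
  by (simp add: commutator_def group_simps)

lemma apply_symb_one [simp]: "a \<in> carrier A \<Longrightarrow> apply_symb A e a \<one> = \<one>"
  by (cases e) (simp_all add: commutator_def star_def)

text \<open>Modulo an ideal its elements become trivial, so an ideal absorbs their commutations with
  arbitrary elements. Conversely, absorbing \<open>[a,x]\<close> gives normality in \<open>(A,\<cdot>)\<close>, absorbing
  \<open>a * x\<close> gives stability under \<open>\<lambda>\<close>, and absorbing \<open>x * a\<close> is what normality in \<open>(A,\<circ>)\<close> adds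
  to these two. The criterion treats the four symbols alike, which makes it fit for
  inductions over commutator words.\<close>

lemma brace_ideal_iff:
  "brace_ideal I A \<longleftrightarrow>
    subgroup I A \<and> (\<forall>e. \<forall>a \<in> carrier A. \<forall>x \<in> I. apply_symb A e a x \<in> I)"
proof (intro iffI conjI allI ballI)
  assume I: "brace_ideal I A"
  then have norm: "I \<lhd> A" "I \<lhd> swap A" and lamI: "\<And>a x. a \<in> carrier A \<Longrightarrow> x \<in> I \<Longrightarrow> lam A a x \<in> I"
    by (auto simp: brace_ideal_def)
  show sub: "subgroup I A" using norm by (simp add: normal_imp_subgroup)
  fix e a x assume a: "a \<in> carrier A" and x: "x \<in> I"
  have xc: "x \<in> carrier A" using x sub by (rule subgroup.mem_carrier[rotated])
  have conj: "b \<otimes> y \<otimes> inv b \<in> I" if "b \<in> carrier A" "y \<in> I" for b y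
    using norm(1) that by (simp add: normal_inv_iff)
  have comm: "commutator A a x \<in> I"
    unfolding commutator_def using conj[OF a x] x sub
    by (simp add: subgroup.m_closed subgroup.m_inv_closed)
  define y where "y = cinv a \<odot> x \<odot> a"
  have "cinv a \<odot> x \<odot> cinv (cinv a) \<in> I"
    using norm(2) a x unfolding circ.normal_inv_iff by (blast intro: circ.inv_closed)
  then have y: "y \<in> I" "x \<odot> a = a \<odot> y"
    using a xc by (simp_all add: y_def circ.m_assoc circ.cancel_left)
  have yc: "y \<in> carrier A" using y sub by (simp add: subgroup.mem_carrier)
  have "star A x a = inv x \<otimes> (a \<otimes> lam A a y \<otimes> inv a)"
    using a xc yc y by (simp add: star_def lam_def[of A x] circ_eq_mult_lam[of a y] m_assoc)
  then have "star A x a \<in> I"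
    using conj[OF a lamI[OF a y(1)]] x sub by (simp add: subgroup.m_closed subgroup.m_inv_closed)
  moreover have "star A a x \<in> I"
    unfolding star_def using lamI[OF a x] x sub
    by (simp add: subgroup.m_closed subgroup.m_inv_closed)
  moreover have "commutator A x a \<in> I"
    using comm subgroup.m_inv_closed[OF sub comm] a xc by (simp add: inv_commutator)
  ultimately show "apply_symb A e a x \<in> I"
    using comm by (cases e) simp_all
next
  assume "subgroup I A \<and> (\<forall>e. \<forall>a \<in> carrier A. \<forall>x \<in> I. apply_symb A e a x \<in> I)"
  then have sub: "subgroup I A"
    and absorb: "\<And>e a x. a \<in> carrier A \<Longrightarrow> x \<in> I \<Longrightarrow> apply_symb A e a x \<in> I" by auto
  note Ic = subgroup.mem_carrier[OF sub]
  have conj: "a \<otimes> x \<otimes> inv a \<in> I" if "a \<in> carrier A" "x \<in> I" for a x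
    using absorb[OF that, of Gam] that sub Ic by (simp add: conj_eq_commutator subgroup.m_closed)
  have lamI: "lam A a x \<in> I" if "a \<in> carrier A" "x \<in> I" for a x
    using absorb[OF that, of Star] that sub Ic by (simp add: lam_eq_star subgroup.m_closed)
  have cinvI: "cinv x \<in> I" if "x \<in> I" for x
    using cinv_eq[of x] lamI[of "cinv x" "inv x"] that sub Ic by (simp add: subgroup.m_inv_closed)
  have subc: "subgroup I (swap A)"
    by (rule subgroup.intro)
      (use Ic sub lamI cinvI in \<open>auto simp: circ_eq_mult_lam subgroup.m_closed subgroup.one_closed\<close>)
  have "a \<odot> x \<odot> cinv a \<in> I" if a: "a \<in> carrier A" and x: "x \<in> I" for a x
  proof -
    have b: "cinv a \<in> carrier A" using a by simp
    \<comment> \<open>Multiplying by \<open>x\<close> under \<open>\<circ>\<close> changes \<open>cinv a\<close> by a left factor \<open>z\<close> from \<open>I\<close>; conjugation turns it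
      into a right factor \<open>w\<close>, which \<open>\<lambda>\<^sub>a\<close> carries through the multiplication by \<open>a\<close>.\<close>
    define z where "z = x \<otimes> star A x (cinv a)"
    have z: "z \<in> I"
      unfolding z_def using absorb[OF b x, of StarBar] x sub by (simp add: subgroup.m_closed)
    define w where "w = inv (cinv a) \<otimes> z \<otimes> cinv a"
    have w: "w \<in> I" unfolding w_def using conj[of "inv (cinv a)" z] b z by simp
    have "x \<odot> cinv a = z \<otimes> cinv a"
      using b x Ic by (simp add: z_def circ_eq_mult_lam lam_eq_star m_assoc)
    also have "\<dots> = cinv a \<otimes> w" using b z Ic by (simp add: w_def m_assoc cancel_left)
    also have "\<dots> = cinv a \<odot> lam A a w"
      using a w Ic by (simp add: circ_eq_mult_lam lam_cinv)
    finally have "a \<odot> x \<odot> cinv a = lam A a w"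
      using a b x w Ic by (simp add: circ.m_assoc) (simp flip: circ.m_assoc)
    then show ?thesis using lamI[OF a w] by simp
  qed
  then have "I \<lhd> swap A" using subc by (simp add: circ.normal_inv_iff)
  moreover have "I \<lhd> A" using conj sub by (simp add: normal_inv_iff)
  ultimately show "brace_ideal I A"
    unfolding brace_ideal_def using lamI by auto
qed

lemma ideal_absorbs:
  "\<lbrakk>brace_ideal I A; a \<in> carrier A; x \<in> I\<rbrakk> \<Longrightarrow> apply_symb A e a x \<in> I"
  by (simp add: brace_ideal_iff)

lemma ideal_subgroup: "brace_ideal I A \<Longrightarrow> subgroup I A"
  by (simp add: brace_ideal_iff)

end

section \<open>Homomorphisms, quotients, sub-braces and products\<close>

lemma brace_hom_iff:
  "f \<in> brace_hom A B \<longleftrightarrow>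
    (\<forall>x \<in> carrier A. f x \<in> carrier B) \<and>
    (\<forall>x \<in> carrier A. \<forall>y \<in> carrier A.
      f (x \<otimes>\<^bsub>A\<^esub> y) = f x \<otimes>\<^bsub>B\<^esub> f y \<and> f (x \<odot>\<^bsub>A\<^esub> y) = f x \<odot>\<^bsub>B\<^esub> f y)"
  by (auto simp: brace_hom_def hom_def)

lemma brace_hom_compose:
  "f \<in> brace_hom A B \<Longrightarrow> g \<in> brace_hom B C \<Longrightarrow> g \<circ> f \<in> brace_hom A C"
  by (simp add: brace_hom_iff)

text \<open>The first isomorphism theorem in a form that mentions neither an ideal nor coset representatives.
  With suitable \<open>p\<close> and \<open>q\<close> it also yields the maps induced on quotients, inverses of isomorphisms,
  and the isomorphism of a brace with its image under an embedding.\<close>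

lemma iso_of_same_fibres:
  assumes mult: "\<And>c d. c \<in> carrier C \<Longrightarrow> d \<in> carrier C \<Longrightarrow> c \<otimes>\<^bsub>C\<^esub> d \<in> carrier C \<and> c \<odot>\<^bsub>C\<^esub> d \<in> carrier C"
    and p: "p \<in> brace_hom C X" "p ` carrier C = carrier X"
    and q: "q \<in> brace_hom C Y" "q ` carrier C = carrier Y"
    and fibres: "\<And>c d. c \<in> carrier C \<Longrightarrow> d \<in> carrier C \<Longrightarrow> p c = p d \<longleftrightarrow> q c = q d"
  obtains h where "h \<in> brace_iso X Y" "\<And>c. c \<in> carrier C \<Longrightarrow> h (p c) = q c"
proof -
  define h where "h = q \<circ> inv_into (carrier C) p"
  have h: "h (p c) = q c" if "c \<in> carrier C" for c
    using that fibres[of "inv_into (carrier C) p (p c)" c]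
    by (simp add: h_def inv_into_into f_inv_into_f)
  have p_op: "p c \<otimes>\<^bsub>X\<^esub> p d = p (c \<otimes>\<^bsub>C\<^esub> d)" "p c \<odot>\<^bsub>X\<^esub> p d = p (c \<odot>\<^bsub>C\<^esub> d)"
    and q_op: "q (c \<otimes>\<^bsub>C\<^esub> d) = q c \<otimes>\<^bsub>Y\<^esub> q d" "q (c \<odot>\<^bsub>C\<^esub> d) = q c \<odot>\<^bsub>Y\<^esub> q d"
    if "c \<in> carrier C" "d \<in> carrier C" for c d
    using p(1) q(1) that by (simp_all add: brace_hom_iff)
  have "h \<in> brace_hom X Y"
    unfolding brace_hom_iff p(2)[symmetric] using mult q(2) by (auto simp: p_op h q_op)
  moreover have "bij_betw h (carrier X) (carrier Y)"
    unfolding bij_betw_def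
  proof
    show "inj_on h (carrier X)"
      by (auto simp: inj_on_def h fibres simp flip: p(2))
    show "h ` carrier X = carrier Y"
      by (auto simp: h image_image simp flip: p(2) q(2))
  qed
  ultimately show thesis using that h by (auto simp: brace_iso_def)
qed

lemma skew_brace_image:
  assumes "skew_brace A" "f \<in> brace_hom A Q" "carrier Q = f ` carrier A" "\<one>\<^bsub>Q\<^esub> = f \<one>\<^bsub>A\<^esub>"
  shows "skew_brace Q"
proof -
  interpret A: skew_brace_ops A by unfold_locales fact
  have Q: "group Q"
    using assms(2-4) by (intro group_image[OF A.is_group, of f]) (auto simp: brace_hom_def)
  moreover have "group (swap Q)"
    using assms(2-4) by (intro group_image[OF A.circ.is_group, of f]) (auto simp: brace_hom_def)
  moreover interpret f: group_hom A Q f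
    using assms(2) by (intro group_hom.intro group_hom_axioms.intro A.is_group Q)
      (simp add: brace_hom_def)
  have circ: "f a \<odot>\<^bsub>Q\<^esub> f b = f (a \<odot>\<^bsub>A\<^esub> b)" if "a \<in> carrier A" "b \<in> carrier A" for a b
    using assms(2) that by (simp add: brace_hom_iff)
  have "f a \<odot>\<^bsub>Q\<^esub> (f b \<otimes>\<^bsub>Q\<^esub> f c) = (f a \<odot>\<^bsub>Q\<^esub> f b) \<otimes>\<^bsub>Q\<^esub> inv\<^bsub>Q\<^esub> f a \<otimes>\<^bsub>Q\<^esub> (f a \<odot>\<^bsub>Q\<^esub> f c)"
    if "a \<in> carrier A" "b \<in> carrier A" "c \<in> carrier A" for a b c
    using that by (simp add: circ A.brace_law flip: f.hom_mult f.hom_inv)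
  then have "\<forall>x \<in> carrier Q. \<forall>y \<in> carrier Q. \<forall>z \<in> carrier Q.
      x \<odot>\<^bsub>Q\<^esub> (y \<otimes>\<^bsub>Q\<^esub> z) = (x \<odot>\<^bsub>Q\<^esub> y) \<otimes>\<^bsub>Q\<^esub> inv\<^bsub>Q\<^esub> x \<otimes>\<^bsub>Q\<^esub> (x \<odot>\<^bsub>Q\<^esub> z)"
    unfolding assms(3) by blast
  ultimately show ?thesis by (simp add: skew_brace_def)
qed

context skew_brace_ops
begin

lemma coset_eq_iff:
  assumes "subgroup I A" "a \<in> carrier A" "b \<in> carrier A"
  shows "I #> a = I #> b \<longleftrightarrow> a \<otimes> inv b \<in> I"
proof
  assume "I #> a = I #> b"
  then have "I #> (a \<otimes> inv b) = I"
    using assms by (simp add: coset_mult_inv2 subgroup.subset)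
  then show "a \<otimes> inv b \<in> I" using assms by (simp add: coset_join1)
next
  assume "a \<otimes> inv b \<in> I"
  then have "I #> (a \<otimes> inv b) = I" using assms by (simp add: coset_join2)
  then show "I #> a = I #> b" using assms by (simp add: coset_mult_inv1 subgroup.subset)
qed

text \<open>For \<open>x\<close> in the ideal, \<open>x \<circ> a = (x \<cdot> (x * a)) \<cdot> a\<close> and the bracketed factor lies in the ideal again.
  Because the cosets agree, both products of cosets are well defined on one and the same set.\<close>

lemma coset_swap:
  assumes I: "brace_ideal I A" and a: "a \<in> carrier A"
  shows "I #>\<^bsub>swap A\<^esub> a = I #> a"
proof -
  note sub = ideal_subgroup[OF I]
  note Ic = subgroup.mem_carrier[OF sub]
  have norm: "I \<lhd> A" "I \<lhd> swap A" and lamI: "\<And>a x. a \<in> carrier A \<Longrightarrow> x \<in> I \<Longrightarrow> lam A a x \<in> I"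
    using I by (auto simp: brace_ideal_def)
  have "x \<odot> a \<in> I #> a" if x: "x \<in> I" for x
  proof -
    have "x \<odot> a = (x \<otimes> star A x a) \<otimes> a"
      using x a Ic by (simp add: circ_eq_mult_lam lam_eq_star m_assoc)
    moreover have "x \<otimes> star A x a \<in> I"
      using ideal_absorbs[OF I a x, of StarBar] x sub by (simp add: subgroup.m_closed)
    ultimately show ?thesis by (auto simp: r_coset_def)
  qed
  moreover have "x \<otimes> a \<in> I #>\<^bsub>swap A\<^esub> a" if x: "x \<in> I" for x
  proof -
    define y where "y = lam A (cinv a) (inv a \<otimes> x \<otimes> a)"
    have y: "y \<in> I"
      unfolding y_def using a x norm(1) lamI by (simp add: normal.inv_op_closed1)
    have "a \<odot> y = x \<otimes> a"
      unfolding y_def using a x Ic by (simp flip: mult_eq_circ_lam add: m_assoc cancel_left)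
    moreover have "(a \<odot> y \<odot> cinv a) \<odot> a = a \<odot> y"
      using a y Ic by (simp add: circ.m_assoc)
    moreover have "a \<odot> y \<odot> cinv a \<in> I"
      using norm(2) a y unfolding circ.normal_inv_iff by blast
    ultimately show ?thesis by (force simp: r_coset_def)
  qed
  ultimately show ?thesis by (auto simp: r_coset_def)
qed

lemma carrier_quotient: "carrier (quotient_brace A I) = (\<lambda>a. I #> a) ` carrier A"
  by (auto simp: quotient_brace_def RCOSETS_def)

lemma coset_hom:
  assumes I: "brace_ideal I A"
  shows "(\<lambda>a. I #> a) \<in> brace_hom A (quotient_brace A I)"
proof -
  have norm: "I \<lhd> A" "I \<lhd> swap A" using I by (auto simp: brace_ideal_def)
  show ?thesis
    unfolding brace_hom_iff carrier_quotient
    using normal.rcos_sum[OF norm(1)] normal.rcos_sum[OF norm(2)]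
    by (auto simp: quotient_brace_def coset_swap[OF I])
qed

lemma coset_one: "subgroup I A \<Longrightarrow> I #> \<one> = I"
  by (simp add: coset_mult_one subgroup.subset)

lemma coset_eq_self: "subgroup I A \<Longrightarrow> a \<in> carrier A \<Longrightarrow> I #> a = I \<longleftrightarrow> a \<in> I"
  using coset_join1 coset_join2 by blast

lemma skew_brace_quotient: "brace_ideal I A \<Longrightarrow> skew_brace (quotient_brace A I)"
  using skew_brace_image[OF skew_brace coset_hom carrier_quotient] coset_one ideal_subgroup
  by (simp add: quotient_brace_def)

end

lemma swap_restrict [simp]: "swap (restrict_brace A H) = restrict_brace (swap A) H"
  by (simp add: swap_def restrict_brace_def)

lemma restrict_simps [simp]:
  "carrier (restrict_brace A H) = H" "mult (restrict_brace A H) = mult A"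
  "circ (restrict_brace A H) = circ A" "\<one>\<^bsub>restrict_brace A H\<^esub> = \<one>\<^bsub>A\<^esub>"
  by (simp_all add: restrict_brace_def)

lemma skew_brace_restrict:
  assumes "skew_brace A" "sub_skew_brace H A"
  shows "skew_brace (restrict_brace A H)"
proof -
  interpret skew_brace_ops A by unfold_locales fact
  have H: "subgroup H A" "subgroup H (swap A)" using assms(2) by (auto simp: sub_skew_brace_def)
  have "group (restrict_brace A H)" "group (swap (restrict_brace A H))"
    using subgroup.subgroup_is_group[OF H(1) is_group]
      subgroup.subgroup_is_group[OF H(2) circ.is_group]
    unfolding swap_restrict by (simp_all add: restrict_brace_def)
  moreover have "inv\<^bsub>restrict_brace A H\<^esub> a = inv\<^bsub>A\<^esub> a" if "a \<in> H" for a
    using m_inv_consistent[OF H(1) that] by (simp add: restrict_brace_def)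
  ultimately show ?thesis
    using H(1) by (auto simp: skew_brace_def brace_law subgroup.mem_carrier)
qed

lemma swap_prod [simp]: "swap (prod_brace A B) = prod_brace (swap A) (swap B)"
  by (simp add: swap_def prod_brace_def)

lemma prod_simps [simp]:
  "carrier (prod_brace A B) = carrier A \<times> carrier B"
  "(a, b) \<otimes>\<^bsub>prod_brace A B\<^esub> (a', b') = (a \<otimes>\<^bsub>A\<^esub> a', b \<otimes>\<^bsub>B\<^esub> b')"
  "(a, b) \<odot>\<^bsub>prod_brace A B\<^esub> (a', b') = (a \<odot>\<^bsub>A\<^esub> a', b \<odot>\<^bsub>B\<^esub> b')"
  "\<one>\<^bsub>prod_brace A B\<^esub> = (\<one>\<^bsub>A\<^esub>, \<one>\<^bsub>B\<^esub>)"
  by (simp_all add: prod_brace_def)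

lemma group_prod:
  assumes "group A" "group B"
  shows "group (prod_brace A B)"
proof -
  interpret A: group A by fact
  interpret B: group B by fact
  show ?thesis
  proof (rule groupI)
    fix x assume "x \<in> carrier (prod_brace A B)"
    then show "\<exists>y \<in> carrier (prod_brace A B). y \<otimes>\<^bsub>prod_brace A B\<^esub> x = \<one>\<^bsub>prod_brace A B\<^esub>"
      by (intro bexI[of _ "(inv\<^bsub>A\<^esub> fst x, inv\<^bsub>B\<^esub> snd x)"]) auto
  qed (auto simp: A.m_assoc B.m_assoc)
qed

lemma inv_prod:
  assumes "group A" "group B" "a \<in> carrier A" "b \<in> carrier B"
  shows "inv\<^bsub>prod_brace A B\<^esub> (a, b) = (inv\<^bsub>A\<^esub> a, inv\<^bsub>B\<^esub> b)"
  using assms by (intro group.inv_equality[OF group_prod]) (auto simp: group.l_inv)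

lemma skew_brace_prod:
  assumes "skew_brace A" "skew_brace B"
  shows "skew_brace (prod_brace A B)"
  using assms by (auto simp: skew_brace_def group_prod inv_prod)

lemma proj_hom:
  "fst \<in> brace_hom (prod_brace A B) A" "snd \<in> brace_hom (prod_brace A B) B"
  by (auto simp: brace_hom_iff)

locale brace_morphism = A: skew_brace_ops A + B: skew_brace_ops B
  for A :: "'a brace" (structure) and B :: "'b brace" (structure) +
  fixes f
  assumes hom: "f \<in> brace_hom A B"

sublocale brace_morphism \<subseteq> group_hom A B f
  using hom by unfold_locales (simp add: brace_hom_def)

context brace_morphism
begin

lemma hom_circ [simp]: "a \<in> carrier A \<Longrightarrow> b \<in> carrier A \<Longrightarrow> f (a \<odot>\<^bsub>A\<^esub> b) = f a \<odot>\<^bsub>B\<^esub> f b"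
  using hom by (simp add: brace_hom_iff)

lemma hom_apply_symb:
  "a \<in> carrier A \<Longrightarrow> b \<in> carrier A \<Longrightarrow> f (apply_symb A e a b) = apply_symb B e (f a) (f b)"
  by (cases e) (simp_all add: star_def lam_def commutator_def)

lemma preimage_ideal:
  assumes "brace_ideal J B"
  shows "brace_ideal {a \<in> carrier A. f a \<in> J} A"
proof -
  note J = B.ideal_subgroup[OF assms]
  have "subgroup {a \<in> carrier A. f a \<in> J} A"
    by (rule A.subgroupI)
      (use J in \<open>auto intro!: exI[of _ "\<one>\<^bsub>A\<^esub>"]
        simp: subgroup.one_closed subgroup.m_closed subgroup.m_inv_closed\<close>)
  then show ?thesis
    unfolding A.brace_ideal_iff using B.ideal_absorbs[OF assms] by (auto simp: hom_apply_symb)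
qed

end

lemma (in skew_brace_ops) trivial_ideal: "brace_ideal {\<one>} A"
  by (simp add: brace_ideal_iff triv_subgroup)

lemma (in brace_morphism) kernel_ideal: "brace_ideal {a \<in> carrier A. f a = \<one>\<^bsub>B\<^esub>} A"
  using preimage_ideal[OF B.trivial_ideal] by simp

section \<open>Commutator words, the annihilator series and the verbal subgroups\<close>

lemma tuples_lift:
  assumes "f ` carrier A = carrier B" "bs \<in> tuples B k"
  obtains as where "as \<in> tuples A k" "map f as = bs"
proof -
  have "bs \<in> map f ` lists (carrier A)"
    using assms by (simp add: tuples_def lists_image[symmetric] in_lists_conv_set subset_iff)
  then obtain as where "as \<in> lists (carrier A)" "bs = map f as" by blast
  with assms(2) show thesis by (intro that[of as]) (auto simp: tuples_def)
qed

lemma word_val_append: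
  "\<lbrakk>length as = length m; length bs = Suc (length m')\<rbrakk> \<Longrightarrow>
    word_val A (m @ m') (as @ bs) = word_val A m (as @ [word_val A m' bs])"
  by (induction m arbitrary: as) (auto simp: length_Suc_conv)

context skew_brace_ops
begin

lemma word_val_closed:
  "\<lbrakk>length as = Suc (length m); set as \<subseteq> carrier A\<rbrakk> \<Longrightarrow> word_val A m as \<in> carrier A"
  by (induction m arbitrary: as) (auto simp: length_Suc_conv)

lemma word_val_tuple [simp]: "as \<in> tuples A (Suc (length m)) \<Longrightarrow> word_val A m as \<in> carrier A"
  by (simp add: tuples_def word_val_closed)

lemma Ann_iff_symb:
  "a \<in> Ann A \<longleftrightarrow> a \<in> carrier A \<and> (\<forall>b \<in> carrier A. \<forall>e. apply_symb A e b a = \<one>)"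
proof -
  have "(\<forall>e. apply_symb A e b a = \<one>) \<longleftrightarrow>
      star A a b = \<one> \<and> star A b a = \<one> \<and> commutator A a b = \<one>"
    (is "?l \<longleftrightarrow> ?r") if "a \<in> carrier A" "b \<in> carrier A" for b
  proof
    assume ?l
    then have "apply_symb A StarBar b a = \<one>" "apply_symb A Star b a = \<one>" "apply_symb A GamBar b a = \<one>"
      by blast+
    then show ?r by simp
  next
    assume r: ?r
    then have "commutator A b a = \<one>" using inv_commutator[of a b] that by simp
    with r have "apply_symb A e b a = \<one>" for e by (cases e) simp_all
    then show ?l by simp
  qed
  then show ?thesis by (auto simp: Ann_def)
qed

text \<open>Equivalently \<open>a\<circ>b = a\<cdot>b = b\<cdot>a = b\<circ>a\<close> for all \<open>b\<close>; in this form closure under products and inverses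
  is visible.\<close>

lemma Ann_iff_lam:
  "a \<in> Ann A \<longleftrightarrow>
    a \<in> carrier A \<and> (\<forall>b \<in> carrier A. lam A a b = b \<and> lam A b a = a \<and> a \<otimes> b = b \<otimes> a)"
proof -
  have "star A a b = \<one> \<longleftrightarrow> lam A a b = b" if "a \<in> carrier A" "b \<in> carrier A" for a b
    using that by (simp add: lam_eq_star)
  moreover have "commutator A a b = \<one> \<longleftrightarrow> a \<otimes> b = b \<otimes> a"
    if "a \<in> carrier A" "b \<in> carrier A" for a b
  proof
    have "a \<otimes> b = commutator A a b \<otimes> (b \<otimes> a)"
      using that by (simp add: commutator_def group_simps)
    then show "commutator A a b = \<one> \<Longrightarrow> a \<otimes> b = b \<otimes> a" using that by simp
    show "commutator A a b = \<one>" if "a \<otimes> b = b \<otimes> a"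
      unfolding commutator_def that using \<open>a \<in> carrier A\<close> \<open>b \<in> carrier A\<close> by (simp add: group_simps)
  qed
  ultimately show ?thesis unfolding Ann_def by auto
qed

lemma Ann_ideal: "brace_ideal (Ann A) A"
proof -
  have "subgroup (Ann A) A"
  proof (rule subgroup.intro)
    fix a b assume "a \<in> Ann A" "b \<in> Ann A"
    then have ab: "a \<in> carrier A" "b \<in> carrier A"
      and a: "\<And>c. c \<in> carrier A \<Longrightarrow> lam A a c = c" "\<And>c. c \<in> carrier A \<Longrightarrow> lam A c a = a"
      and a_comm: "\<And>c. c \<in> carrier A \<Longrightarrow> a \<otimes> c = c \<otimes> a"
      and b: "\<And>c. c \<in> carrier A \<Longrightarrow> lam A b c = c" "\<And>c. c \<in> carrier A \<Longrightarrow> lam A c b = b"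
      and b_comm: "\<And>c. c \<in> carrier A \<Longrightarrow> b \<otimes> c = c \<otimes> b"
      unfolding Ann_iff_lam by auto
    have "lam A (a \<otimes> b) c = c" if "c \<in> carrier A" for c
      using lam_circ[of a b c] ab that by (simp add: circ_eq_mult_lam a b)
    moreover have "a \<otimes> b \<otimes> c = c \<otimes> (a \<otimes> b)" if c: "c \<in> carrier A" for c
    proof -
      have "a \<otimes> b \<otimes> c = a \<otimes> c \<otimes> b" using ab b_comm[OF c] c by (simp add: m_assoc)
      also have "\<dots> = c \<otimes> (a \<otimes> b)" using ab c by (simp add: a_comm[OF c] m_assoc)
      finally show ?thesis .
    qed
    ultimately show "a \<otimes> b \<in> Ann A"
      using ab by (simp add: Ann_iff_lam lam_mult a b)
  next
    fix a assume "a \<in> Ann A"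
    then have ac: "a \<in> carrier A"
      and a: "\<And>c. c \<in> carrier A \<Longrightarrow> lam A a c = c" "\<And>c. c \<in> carrier A \<Longrightarrow> lam A c a = a"
      and a_comm: "\<And>c. c \<in> carrier A \<Longrightarrow> a \<otimes> c = c \<otimes> a"
      unfolding Ann_iff_lam by auto
    have "inv a \<odot> a = \<one>" using ac by (simp add: circ_eq_mult_lam a)
    then have "cinv a = inv a" using ac by (simp add: circ.inv_equality)
    then have "lam A (inv a) c = c" if "c \<in> carrier A" for c
      using lam_cinv(2)[of a c] ac that by (simp add: a)
    moreover have "inv a \<otimes> c = c \<otimes> inv a" if "c \<in> carrier A" for c
    proof -
      have "inv a \<otimes> (c \<otimes> a) \<otimes> inv a = c \<otimes> inv a"
        using ac that a_comm[OF that] by (metis inv_closed l_inv l_one m_assoc)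
      then show ?thesis using ac that by (simp add: m_assoc)
    qed
    ultimately show "inv a \<in> Ann A"
      using ac by (simp add: Ann_iff_lam lam_inv a)
  qed (auto simp: Ann_iff_lam)
  moreover from this have "\<one> \<in> Ann A" by (rule subgroup.one_closed)
  ultimately show ?thesis
    by (auto simp: brace_ideal_iff Ann_iff_symb)
qed

lemma upper_ann_ideal: "brace_ideal (upper_ann A n) A"
proof (induction n)
  case 0
  then show ?case by (simp add: trivial_ideal)
next
  case (Suc n)
  interpret p: brace_morphism A "quot_ann A n" "\<lambda>a. upper_ann A n #> a"
    using coset_hom[OF Suc] skew_brace_quotient[OF Suc] by unfold_locales
  from p.preimage_ideal[OF p.B.Ann_ideal] show ?case by simp
qed

lemma upper_ann_Suc_iff:
  "c \<in> upper_ann A (Suc n) \<longleftrightarrow>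
    c \<in> carrier A \<and> (\<forall>a \<in> carrier A. \<forall>e. apply_symb A e a c \<in> upper_ann A n)"
proof -
  interpret p: brace_morphism A "quot_ann A n" "\<lambda>a. upper_ann A n #> a"
    using coset_hom[OF upper_ann_ideal] skew_brace_quotient[OF upper_ann_ideal] by unfold_locales
  have one: "\<one>\<^bsub>quot_ann A n\<^esub> = upper_ann A n" by (simp add: quotient_brace_def)
  have "apply_symb (quot_ann A n) e (upper_ann A n #> a) (upper_ann A n #> c) = upper_ann A n \<longleftrightarrow>
      apply_symb A e a c \<in> upper_ann A n" if "a \<in> carrier A" "c \<in> carrier A" for a and e :: symb
    using that by (simp flip: p.hom_apply_symb add: coset_eq_self ideal_subgroup upper_ann_ideal)
  then show ?thesis
    by (auto simp: p.B.Ann_iff_symb carrier_quotient one)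
qed

text \<open>Each step of the recursion commutes the element once more before testing it, so unfolding collects
  the commutations into a word of degree \<open>n\<close> with \<open>c\<close> in the last place. In this form the
  series can be compared along a homomorphism without mentioning a quotient.\<close>

lemma upper_ann_iff_words:
  "c \<in> upper_ann A n \<longleftrightarrow>
    c \<in> carrier A \<and> (\<forall>m as. length m = n \<longrightarrow> as \<in> tuples A n \<longrightarrow> word_val A m (as @ [c]) = \<one>)"
proof (induction n arbitrary: c)
  case 0
  then show ?case by (auto simp: tuples_def)
next
  case (Suc n)
  have snoc: "word_val A (m @ [e]) (as @ [a, c]) = word_val A m (as @ [apply_symb A e a c])"
    if "length m = length as" for m :: "symb list" and e :: symb and as :: "'a list" and a :: 'a
    using that by (simp add: word_val_append)
  show ?case
  proof (cases "c \<in> carrier A")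
    case c: True
    have "(\<forall>a \<in> carrier A. \<forall>e. apply_symb A e a c \<in> upper_ann A n) \<longleftrightarrow>
        (\<forall>m as. length m = Suc n \<longrightarrow> as \<in> tuples A (Suc n) \<longrightarrow> word_val A m (as @ [c]) = \<one>)"
      (is "?l \<longleftrightarrow> ?r")
    proof
      assume l: ?l
      show ?r
      proof (intro allI impI)
        fix m :: "symb list" and as assume m: "length m = Suc n" and as: "as \<in> tuples A (Suc n)"
        obtain m' e where m': "m = m' @ [e]" "length m' = n"
          using m by (auto simp: length_Suc_conv_rev)
        obtain as' a where as': "as = as' @ [a]" "length as' = n"
          using as by (auto simp: tuples_def length_Suc_conv_rev)
        have "apply_symb A e a c \<in> upper_ann A n" "as' \<in> tuples A n"
          using l as as' by (auto simp: tuples_def)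
        then show "word_val A m (as @ [c]) = \<one>"
          using Suc.IH m' as' snoc[of m' as' e a] by simp
      qed
    next
      assume r: ?r
      have "word_val A m (as @ [apply_symb A e a c]) = \<one>"
        if "a \<in> carrier A" "length m = n" "as \<in> tuples A n" for a e m as
        using r[rule_format, of "m @ [e]" "as @ [a]"] that snoc[of m as e a]
        by (simp add: tuples_def)
      then show ?l using c by (auto simp: Suc.IH)
    qed
    with c show ?thesis unfolding upper_ann_Suc_iff by simp
  qed (simp add: upper_ann_Suc_iff)
qed

text \<open>A word of degree at least \<open>t\<close> is a word of degree exactly \<open>t\<close> with the value of the remaining
  word as its last argument, so longer words contribute no new generators.\<close>

lemma verbal_eq:
  "verbal A t = generate A {word_val A m as | m as. length m = t \<and> as \<in> tuples A (t + 1)}"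
proof -
  have "\<exists>m' as'. word_val A m as = word_val A m' as' \<and> length m' = t \<and> as' \<in> tuples A (t + 1)"
    if m: "length m \<ge> t" and as: "as \<in> tuples A (length m + 1)" for m as
  proof (intro exI conjI)
    let ?w = "word_val A (drop t m) (drop t as)"
    have "set (drop t as) \<subseteq> carrier A" "set (take t as) \<subseteq> carrier A"
      using as set_drop_subset[of t as] set_take_subset[of t as] by (auto simp: tuples_def)
    then show "take t as @ [?w] \<in> tuples A (t + 1)"
      using m as by (auto simp: tuples_def intro!: word_val_closed)
    show "word_val A m as = word_val A (take t m) (take t as @ [?w])"
      using word_val_append[of "take t as" "take t m" "drop t as" "drop t m" A] m as
      by (simp add: tuples_def)
  qed (use m in simp)
  then have "{word_val A m as | m as. length m \<ge> t \<and> as \<in> tuples A (length m + 1)} =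
      {word_val A m as | m as. length m = t \<and> as \<in> tuples A (t + 1)}"
    by auto
  then show ?thesis by (simp add: verbal_def)
qed

lemma word_val_verbal: "length m \<ge> t \<Longrightarrow> as \<in> tuples A (length m + 1) \<Longrightarrow> word_val A m as \<in> verbal A t"
  unfolding verbal_def by (auto intro!: generate.incl)

lemma verbal_subgroup: "subgroup (verbal A t) A"
  unfolding verbal_eq by (rule generate_is_subgroup) auto

lemma verbal_closed: "x \<in> verbal A t \<Longrightarrow> x \<in> carrier A"
  using verbal_subgroup by (rule subgroup.mem_carrier)

lemma apply_symb_word:
  assumes "a \<in> carrier A" "as \<in> tuples A (length m + 1)" "length m + 1 \<ge> t"
  shows "apply_symb A e a (word_val A m as) \<in> verbal A t"
  using word_val_verbal[of t "e # m" "a # as"] assms by (simp add: tuples_def)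

text \<open>For a generator \<open>w\<close> one has \<open>\<lambda>\<^sub>a(w) = (a * w) \<cdot> w\<close> and \<open>a\<cdot>w\<cdot>a\<^sup>-\<^sup>1 = [a,w] \<cdot> w\<close>, and the first factors
  are words of higher degree. Both maps are endomorphisms of \<open>(A,\<cdot>)\<close>, so this extends to the
  generated subgroup.\<close>

lemma verbal_stable:
  assumes a: "a \<in> carrier A" and x: "x \<in> verbal A t"
  shows "lam A a x \<in> verbal A t" "a \<otimes> x \<otimes> inv a \<in> verbal A t"
proof -
  note V = subgroup.one_closed[OF verbal_subgroup] subgroup.m_closed[OF verbal_subgroup]
    subgroup.m_inv_closed[OF verbal_subgroup]
  let ?S = "{word_val A m as | m as. length m = t \<and> as \<in> tuples A (t + 1)}"
  have gen: "lam A a w \<in> verbal A t" "a \<otimes> w \<otimes> inv a \<in> verbal A t" "w \<in> carrier A"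
    if "w \<in> ?S" for w
  proof -
    from that obtain m as where w: "w = word_val A m as" "length m = t" "as \<in> tuples A (t + 1)"
      by auto
    then show "w \<in> carrier A" by auto
    moreover have "w \<in> verbal A t" using w word_val_verbal by auto
    moreover have "apply_symb A e a w \<in> verbal A t" for e
      using apply_symb_word[OF a] w by auto
    from this[of Star] this[of Gam] have "star A a w \<in> verbal A t" "commutator A a w \<in> verbal A t"
      by simp_all
    ultimately show "lam A a w \<in> verbal A t" "a \<otimes> w \<otimes> inv a \<in> verbal A t"
      using a V by (simp_all add: lam_eq_star conj_eq_commutator)
  qed
  from x[unfolded verbal_eq] have "lam A a x \<in> verbal A t \<and> a \<otimes> x \<otimes> inv a \<in> verbal A t"
  proof (induction rule: generate.induct)
    case one
    then show ?case using a V by simp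
  next
    case (incl h)
    then show ?case using gen by blast
  next
    case (inv h)
    have "a \<otimes> inv h \<otimes> inv a = inv (a \<otimes> h \<otimes> inv a)"
      using a gen(3)[OF inv] by (simp add: group_simps)
    then show ?case using a V gen[OF inv] by (simp add: lam_inv)
  next
    case (eng h1 h2)
    then have h: "h1 \<in> carrier A" "h2 \<in> carrier A"
      using verbal_closed unfolding verbal_eq by blast+
    have "a \<otimes> (h1 \<otimes> h2) \<otimes> inv a = (a \<otimes> h1 \<otimes> inv a) \<otimes> (a \<otimes> h2 \<otimes> inv a)"
      using a h by (simp add: group_simps)
    then show ?case using a h V eng.IH by (simp add: lam_mult)
  qed
  then show "lam A a x \<in> verbal A t" "a \<otimes> x \<otimes> inv a \<in> verbal A t" by simp_all
qed

lemma verbal_circ_closed: "x \<in> verbal A t \<Longrightarrow> y \<in> verbal A t \<Longrightarrow> x \<odot> y \<in> verbal A t"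
  using verbal_stable(1)[of x y t] verbal_closed[of _ t] verbal_subgroup[of t]
  by (simp add: circ_eq_mult_lam subgroup.m_closed)

lemma phi_coset_tuple:
  "\<lbrakk>phi_well_defined A n m; as \<in> tuples A (n + 1)\<rbrakk> \<Longrightarrow> phi A n m (coset_tuple A n as) = word_val A m as"
  unfolding phi_def phi_well_defined_def by (rule the_equality) metis+

lemma coset_tuple_closed: "as \<in> tuples A k \<Longrightarrow> coset_tuple A n as \<in> tuples (quot_ann A n) k"
  by (auto simp: tuples_def coset_tuple_def carrier_quotient)

lemma coset_tuple_lift:
  assumes "Xs \<in> tuples (quot_ann A n) k"
  obtains as where "as \<in> tuples A k" "coset_tuple A n as = Xs"
  using tuples_lift[OF carrier_quotient[symmetric] assms] by (auto simp: coset_tuple_def)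

end

context brace_morphism
begin

lemma hom_word_val:
  "\<lbrakk>length as = Suc (length m); set as \<subseteq> carrier A\<rbrakk> \<Longrightarrow>
    f (word_val A m as) = word_val B m (map f as)"
proof (induction m arbitrary: as)
  case (Cons e m)
  then show ?case by (auto simp: length_Suc_conv hom_apply_symb A.word_val_closed)
qed (auto simp: length_Suc_conv)

lemma map_tuples: "as \<in> tuples A k \<Longrightarrow> map f as \<in> tuples B k"
  by (auto simp: tuples_def)

lemma verbal_image:
  assumes surj: "f ` carrier A = carrier B"
  shows "f ` verbal A t = verbal B t"
proof -
  let ?S = "\<lambda>A m. word_val A m ` tuples A (t + 1)"
  have word: "f ` ?S A m = ?S B m" if "length m = t" for m
  proof -
    have "f ` ?S A m = word_val B m ` map f ` tuples A (t + 1)"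
      using that by (auto simp: image_image tuples_def hom_word_val intro!: image_cong)
    also have "map f ` tuples A (t + 1) = tuples B (t + 1)"
      using map_tuples by (auto elim!: tuples_lift[OF surj])
    finally show ?thesis .
  qed
  have "f ` generate A (\<Union>m \<in> {m. length m = t}. ?S A m) = generate B (\<Union>m \<in> {m. length m = t}. ?S B m)"
    by (subst generate_img[symmetric]) (use word in \<open>auto simp: image_UN\<close>)
  moreover have "verbal A t = generate A (\<Union>m \<in> {m. length m = t}. ?S A m)"
    "verbal B t = generate B (\<Union>m \<in> {m. length m = t}. ?S B m)"
    unfolding A.verbal_eq B.verbal_eq by (rule arg_cong[where f = "generate _"]; auto)+
  ultimately show ?thesis by simp
qed

end

section \<open>Isoclinism\<close>

lemma brace_iso_inv:
  assumes mult: "\<And>x y. x \<in> carrier X \<Longrightarrow> y \<in> carrier X \<Longrightarrow> x \<otimes>\<^bsub>X\<^esub> y \<in> carrier X \<and> x \<odot>\<^bsub>X\<^esub> y \<in> carrier X"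
    and h: "h \<in> brace_iso X Y"
  obtains g where "g \<in> brace_iso Y X" "\<And>x. x \<in> carrier X \<Longrightarrow> g (h x) = x"
proof -
  have bij: "h ` carrier X = carrier Y" "inj_on h (carrier X)"
    using h by (auto simp: brace_iso_def bij_betw_def)
  show thesis
  proof (rule iso_of_same_fibres[of X h Y "\<lambda>x. x" X])
    show "h \<in> brace_hom X Y" using h by (simp add: brace_iso_def)
    show "(\<lambda>x. x) \<in> brace_hom X X" by (simp add: brace_hom_iff)
    show "h c = h d \<longleftrightarrow> c = d" if "c \<in> carrier X" "d \<in> carrier X" for c d
      using bij(2) that by (auto simp: inj_on_def)
    show thesis if "g \<in> brace_iso Y X" "\<And>c. c \<in> carrier X \<Longrightarrow> g (h c) = c" for g
      using that by (rule \<open>\<And>g. \<lbrakk>g \<in> brace_iso Y X; \<And>x. x \<in> carrier X \<Longrightarrow> g (h x) = x\<rbrakk> \<Longrightarrow> thesis\<close>)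
  qed (use mult bij in auto)
qed

lemma brace_iso_compose:
  "f \<in> brace_iso X Y \<Longrightarrow> g \<in> brace_iso Y Z \<Longrightarrow> g \<circ> f \<in> brace_iso X Z"
  by (auto simp: brace_iso_def intro: brace_hom_compose bij_betw_trans)

lemma brace_isoE:
  assumes "h \<in> brace_iso X Y"
  shows "h \<in> brace_hom X Y" "h ` carrier X = carrier Y" "inj_on h (carrier X)"
  using assms by (auto simp: brace_iso_def bij_betw_def)

lemma map_iso_tuples: "h \<in> brace_iso X Y \<Longrightarrow> Xs \<in> tuples X k \<Longrightarrow> map h Xs \<in> tuples Y k"
  by (auto simp: tuples_def brace_iso_def brace_hom_iff)

lemma in_class_skew_brace: "in_class_I n A \<Longrightarrow> skew_brace A"
  by (simp add: in_class_I_def)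

lemma isoclinic_trans:
  assumes AB: "isoclinic n A B" and BC: "isoclinic n B C"
  shows "isoclinic n A C"
proof -
  obtain \<xi> \<theta> where 1: "\<xi> \<in> brace_iso (quot_ann A n) (quot_ann B n)"
    "\<theta> \<in> brace_iso (restrict_brace A (verbal A n)) (restrict_brace B (verbal B n))"
    "\<And>m Xs. length m = n \<Longrightarrow> Xs \<in> tuples (quot_ann A n) (n + 1) \<Longrightarrow>
      \<theta> (phi A n m Xs) = phi B n m (map \<xi> Xs)"
    using AB by (auto simp: isoclinic_def)
  obtain \<xi>' \<theta>' where 2: "\<xi>' \<in> brace_iso (quot_ann B n) (quot_ann C n)"
    "\<theta>' \<in> brace_iso (restrict_brace B (verbal B n)) (restrict_brace C (verbal C n))"
    "\<And>m Xs. length m = n \<Longrightarrow> Xs \<in> tuples (quot_ann B n) (n + 1) \<Longrightarrow>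
      \<theta>' (phi B n m Xs) = phi C n m (map \<xi>' Xs)"
    using BC by (auto simp: isoclinic_def)
  have "(\<theta>' \<circ> \<theta>) (phi A n m Xs) = phi C n m (map (\<xi>' \<circ> \<xi>) Xs)"
    if "length m = n" "Xs \<in> tuples (quot_ann A n) (n + 1)" for m Xs
    using 1(3)[OF that] 2(3)[OF that(1) map_iso_tuples[OF 1(1) that(2)]] by simp
  then show ?thesis
    using AB BC brace_iso_compose[OF 1(1) 2(1)] brace_iso_compose[OF 1(2) 2(2)]
    unfolding isoclinic_def by blast
qed

text \<open>An inverse of \<open>\<theta>\<close> is a brace homomorphism because the verbal subgroup is closed under
  both operations.\<close>

lemma isoclinic_sym:
  assumes AB: "isoclinic n A B"
  shows "isoclinic n B A"
proof -
  have cls: "in_class_I n A" "in_class_I n B" using AB by (auto simp: isoclinic_def)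
  interpret A: skew_brace_ops A using cls in_class_skew_brace by unfold_locales
  interpret Q: skew_brace_ops "quot_ann A n"
    using A.skew_brace_quotient[OF A.upper_ann_ideal] by unfold_locales
  obtain \<xi> \<theta> where \<xi>: "\<xi> \<in> brace_iso (quot_ann A n) (quot_ann B n)"
    and \<theta>: "\<theta> \<in> brace_iso (restrict_brace A (verbal A n)) (restrict_brace B (verbal B n))"
    and phi: "\<And>m Xs. length m = n \<Longrightarrow> Xs \<in> tuples (quot_ann A n) (n + 1) \<Longrightarrow>
      \<theta> (phi A n m Xs) = phi B n m (map \<xi> Xs)"
    using AB by (auto simp: isoclinic_def)
  obtain \<xi>' where \<xi>': "\<xi>' \<in> brace_iso (quot_ann B n) (quot_ann A n)"
    "\<And>x. x \<in> carrier (quot_ann A n) \<Longrightarrow> \<xi>' (\<xi> x) = x"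
    by (rule brace_iso_inv[OF _ \<xi>]) auto
  obtain \<theta>' where \<theta>': "\<theta>' \<in> brace_iso (restrict_brace B (verbal B n)) (restrict_brace A (verbal A n))"
    "\<And>x. x \<in> verbal A n \<Longrightarrow> \<theta>' (\<theta> x) = x"
    by (rule brace_iso_inv[OF _ \<theta>])
      (auto simp: subgroup.m_closed[OF A.verbal_subgroup] A.verbal_circ_closed)
  have "\<theta>' (phi B n m Ys) = phi A n m (map \<xi>' Ys)"
    if m: "length m = n" and Ys: "Ys \<in> tuples (quot_ann B n) (n + 1)" for m Ys
  proof -
    obtain Xs where Xs: "Xs \<in> tuples (quot_ann A n) (n + 1)" "map \<xi> Xs = Ys"
      by (rule tuples_lift[OF brace_isoE(2)[OF \<xi>] Ys])
    have "map \<xi>' Ys = Xs"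
      using Xs(1) \<xi>'(2) unfolding Xs(2)[symmetric] map_map
      by (intro map_idI) (auto simp: tuples_def subset_iff)
    moreover have "phi A n m Xs \<in> verbal A n"
    proof -
      obtain as where "as \<in> tuples A (n + 1)" "coset_tuple A n as = Xs"
        by (rule A.coset_tuple_lift[OF Xs(1)])
      then show ?thesis
        using cls(1) m A.phi_coset_tuple[of n m as] A.word_val_verbal[of n m as]
        by (auto simp: in_class_I_def)
    qed
    ultimately show ?thesis
      using phi[OF m Xs(1)] \<theta>'(2) Xs(2) by metis
  qed
  then show ?thesis
    using cls \<xi>'(1) \<theta>'(1) unfolding isoclinic_def by blast
qed

context brace_morphism
begin

lemma verbal_inj_on:
  assumes ker: "\<And>x. x \<in> verbal A n \<Longrightarrow> f x = \<one>\<^bsub>B\<^esub> \<Longrightarrow> x = \<one>\<^bsub>A\<^esub>"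
  shows "inj_on f (verbal A n)"
proof (rule inj_onI)
  fix x y assume xy: "x \<in> verbal A n" "y \<in> verbal A n" "f x = f y"
  note V = A.verbal_subgroup[of n]
  have "f (x \<otimes>\<^bsub>A\<^esub> inv\<^bsub>A\<^esub> y) = \<one>\<^bsub>B\<^esub>"
    using xy by (simp add: A.verbal_closed)
  then have "x \<otimes>\<^bsub>A\<^esub> inv\<^bsub>A\<^esub> y = \<one>\<^bsub>A\<^esub>"
    using ker xy V by (simp add: subgroup.m_closed subgroup.m_inv_closed)
  then show "x = y" using xy A.verbal_closed A.inv_equality A.inv_inv by (metis A.inv_closed)
qed

text \<open>Membership in \<open>Ann\<^sub>n\<close> says that certain values in the verbal subgroup vanish, and there \<open>f\<close> detects
  vanishing; surjectivity provides all arguments needed in \<open>B\<close>.\<close>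

lemma upper_ann_preimage:
  assumes surj: "f ` carrier A = carrier B"
    and ker: "\<And>x. x \<in> verbal A n \<Longrightarrow> f x = \<one>\<^bsub>B\<^esub> \<Longrightarrow> x = \<one>\<^bsub>A\<^esub>"
    and c: "c \<in> carrier A"
  shows "c \<in> upper_ann A n \<longleftrightarrow> f c \<in> upper_ann B n"
proof -
  have word: "word_val A m (as @ [c]) = \<one>\<^bsub>A\<^esub> \<longleftrightarrow> word_val B m (map f as @ [f c]) = \<one>\<^bsub>B\<^esub>"
    if "length m = n" "as \<in> tuples A n" for m as
  proof -
    have as: "as @ [c] \<in> tuples A (length m + 1)" using that c by (auto simp: tuples_def)
    then have "f (word_val A m (as @ [c])) = word_val B m (map f as @ [f c])"
      using hom_word_val[of "as @ [c]" m] by (auto simp: tuples_def)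
    then show ?thesis
      using ker[OF A.word_val_verbal[OF _ as]] that by auto
  qed
  show ?thesis
  proof
    assume L: "c \<in> upper_ann A n"
    have "word_val B m (bs @ [f c]) = \<one>\<^bsub>B\<^esub>" if m: "length m = n" and bs: "bs \<in> tuples B n" for m bs
    proof -
      obtain as where "as \<in> tuples A n" "map f as = bs" by (rule tuples_lift[OF surj bs])
      then show ?thesis using L word m by (auto simp: A.upper_ann_iff_words)
    qed
    then show "f c \<in> upper_ann B n" using c by (simp add: B.upper_ann_iff_words)
  next
    assume "f c \<in> upper_ann B n"
    then show "c \<in> upper_ann A n"
      using c word map_tuples by (auto simp: A.upper_ann_iff_words B.upper_ann_iff_words)
  qed
qed

text \<open>On the verbal subgroup \<open>f\<close> is bijective, by the hypothesis on the kernel. Since it matches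
  \<open>Ann\<^sub>n(A)\<close> with \<open>Ann\<^sub>n(B)\<close> in both directions, it also induces an isomorphism of the quotients.
  Words commute with \<open>f\<close>, so the maps \<open>\<phi>\<^sub>m\<close> of the two braces determine each other; in particular
  well-definedness passes from either brace to the other.\<close>

theorem isoclinic_surjection:
  assumes surj: "f ` carrier A = carrier B"
    and ker: "\<And>x. x \<in> verbal A n \<Longrightarrow> f x = \<one>\<^bsub>B\<^esub> \<Longrightarrow> x = \<one>\<^bsub>A\<^esub>"
    and cls: "in_class_I n A \<or> in_class_I n B"
  shows "isoclinic n A B"
proof -
  let ?p = "\<lambda>a. upper_ann A n #>\<^bsub>A\<^esub> a" and ?q = "\<lambda>b. upper_ann B n #>\<^bsub>B\<^esub> b"
  have pq: "?p c = ?p d \<longleftrightarrow> ?q (f c) = ?q (f d)" if "c \<in> carrier A" "d \<in> carrier A" for c d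
    using that upper_ann_preimage[OF surj ker, of n "c \<otimes>\<^bsub>A\<^esub> inv\<^bsub>A\<^esub> d"]
    by (simp add: A.coset_eq_iff B.coset_eq_iff A.ideal_subgroup A.upper_ann_ideal
        B.ideal_subgroup B.upper_ann_ideal)
  obtain \<xi> where \<xi>: "\<xi> \<in> brace_iso (quot_ann A n) (quot_ann B n)"
    and \<xi>_coset: "\<And>c. c \<in> carrier A \<Longrightarrow> \<xi> (?p c) = (?q \<circ> f) c"
  proof (rule iso_of_same_fibres[of A ?p "quot_ann A n" "?q \<circ> f" "quot_ann B n"])
    show "?q \<circ> f \<in> brace_hom A (quot_ann B n)"
      using brace_hom_compose[OF hom B.coset_hom[OF B.upper_ann_ideal]] .
    show "(?q \<circ> f) ` carrier A = carrier (quot_ann B n)"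
      unfolding image_comp[symmetric] surj B.carrier_quotient ..
    show "?p \<in> brace_hom A (quot_ann A n)" by (rule A.coset_hom[OF A.upper_ann_ideal])
    show "?p ` carrier A = carrier (quot_ann A n)" by (rule A.carrier_quotient[symmetric])
    show "?p c = ?p d \<longleftrightarrow> (?q \<circ> f) c = (?q \<circ> f) d" if "c \<in> carrier A" "d \<in> carrier A" for c d
      using pq[OF that] by simp
    show thesis if "h \<in> brace_iso (quot_ann A n) (quot_ann B n)"
      "\<And>c. c \<in> carrier A \<Longrightarrow> h (?p c) = (?q \<circ> f) c" for h
      using that by (rule \<open>\<And>\<xi>. \<lbrakk>\<xi> \<in> brace_iso (quot_ann A n) (quot_ann B n);
        \<And>c. c \<in> carrier A \<Longrightarrow> \<xi> (?p c) = (?q \<circ> f) c\<rbrakk> \<Longrightarrow> thesis\<close>)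
  qed simp
  have coset_map: "coset_tuple B n (map f as) = map \<xi> (coset_tuple A n as)" if "as \<in> tuples A k" for as k
    using that \<xi>_coset unfolding coset_tuple_def tuples_def map_map
    by (intro map_cong) (simp_all add: subset_iff)
  have coset_eq: "coset_tuple B n (map f as) = coset_tuple B n (map f bs) \<longleftrightarrow>
      coset_tuple A n as = coset_tuple A n bs" if "as \<in> tuples A k" "bs \<in> tuples A k" for as bs k
  proof -
    have "set (coset_tuple A n as) \<union> set (coset_tuple A n bs) \<subseteq> carrier (quot_ann A n)"
      using A.coset_tuple_closed that by (simp add: tuples_def)
    then show ?thesis
      unfolding coset_map[OF that(1)] coset_map[OF that(2)]
      by (rule inj_on_map_eq_map[OF inj_on_subset[OF brace_isoE(3)[OF \<xi>]]])
  qed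
  have word: "f (word_val A m as) = word_val B m (map f as)" "word_val A m as \<in> verbal A n"
    if "length m = n" "as \<in> tuples A (n + 1)" for m as
    using that hom_word_val[of as m] A.word_val_verbal[of n m as] by (auto simp: tuples_def)
  have inj: "inj_on f (verbal A n)" using verbal_inj_on ker .
  have wd: "phi_well_defined A n m \<longleftrightarrow> phi_well_defined B n m" if m: "length m = n" for m
  proof
    assume wdA: "phi_well_defined A n m"
    show "phi_well_defined B n m"
      unfolding phi_well_defined_def
    proof (intro ballI impI)
      fix as' bs' assume B: "as' \<in> tuples B (n + 1)" "bs' \<in> tuples B (n + 1)"
        and eq: "coset_tuple B n as' = coset_tuple B n bs'"
      obtain as where as: "as \<in> tuples A (n + 1)" "map f as = as'" by (rule tuples_lift[OF surj B(1)])
      obtain bs where bs: "bs \<in> tuples A (n + 1)" "map f bs = bs'" by (rule tuples_lift[OF surj B(2)])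
      have "word_val A m as = word_val A m bs"
        using wdA as(1) bs(1) eq coset_eq[OF as(1) bs(1)]
        unfolding as(2) bs(2) phi_well_defined_def by blast
      then show "word_val B m as' = word_val B m bs'"
        using word(1)[OF m] as bs by metis
    qed
  next
    assume wdB: "phi_well_defined B n m"
    show "phi_well_defined A n m"
      unfolding phi_well_defined_def
    proof (intro ballI impI)
      fix as bs assume A: "as \<in> tuples A (n + 1)" "bs \<in> tuples A (n + 1)"
        and "coset_tuple A n as = coset_tuple A n bs"
      then have "f (word_val A m as) = f (word_val A m bs)"
        using wdB coset_eq[OF A] map_tuples[OF A(1)] map_tuples[OF A(2)]
        unfolding word(1)[OF m A(1)] word(1)[OF m A(2)] phi_well_defined_def by blast
      then show "word_val A m as = word_val A m bs"
        by (rule inj_onD[OF inj _ word(2)[OF m A(1)] word(2)[OF m A(2)]])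
    qed
  qed
  then have cls: "in_class_I n A" "in_class_I n B"
    using cls A.skew_brace B.skew_brace by (auto simp: in_class_I_def)
  have "f \<in> brace_iso (restrict_brace A (verbal A n)) (restrict_brace B (verbal B n))"
  proof -
    have "f x \<in> verbal B n" if "x \<in> verbal A n" for x
      using that verbal_image[OF surj, of n] by blast
    then have "f \<in> brace_hom (restrict_brace A (verbal A n)) (restrict_brace B (verbal B n))"
      by (simp add: brace_hom_iff A.verbal_closed)
    then show ?thesis
      using inj verbal_image[OF surj, of n] by (simp add: brace_iso_def bij_betw_def)
  qed
  moreover have "f (phi A n m Xs) = phi B n m (map \<xi> Xs)"
    if m: "length m = n" and Xs: "Xs \<in> tuples (quot_ann A n) (n + 1)" for m Xs
  proof -
    obtain as where as: "as \<in> tuples A (n + 1)" "coset_tuple A n as = Xs"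
      by (rule A.coset_tuple_lift[OF Xs])
    show ?thesis
      using cls m as A.phi_coset_tuple[of n m as] B.phi_coset_tuple[of n m "map f as"]
        map_tuples[OF as(1)] word(1)[OF m as(1)] coset_map[OF as(1)]
      by (simp add: in_class_I_def)
  qed
  ultimately show ?thesis
    unfolding isoclinic_def using cls \<xi> by blast
qed

end

section \<open>The lower central series\<close>

context skew_brace_ops
begin

lemma lower_central_step:
  assumes "a \<in> carrier A" "u \<in> lower_central A (Suc k)" "lower_central A (Suc k) \<subseteq> carrier A"
  shows "apply_symb A e a u \<in> lower_central A (Suc (Suc k))"
proof -
  let ?G = "\<Union>a \<in> carrier A. \<Union>u \<in> lower_central A (Suc k). {star A a u, star A u a, commutator A a u}"
  have u: "u \<in> carrier A" using assms(2,3) by blast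
  have gens: "star A a u \<in> ?G" "star A u a \<in> ?G" "commutator A a u \<in> ?G" using assms(1,2) by blast+
  have "commutator A u a = inv (commutator A a u)"
    using assms(1) u by (simp add: inv_commutator)
  then have "commutator A u a \<in> generate A ?G"
    using generate.inv[OF gens(3), of A] by simp
  then show ?thesis
    using gens by (cases e) (auto intro: generate.incl)
qed

text \<open>Each term contains all commutations of the brace with the preceding term. Being contained in that
  term, it contains the commutations with its own elements in particular.\<close>

lemma lower_central_ideal: "brace_ideal (lower_central A k) A"
proof (induction k)
  case 0
  show ?case by (simp add: brace_ideal_iff subgroup_self)
next
  case (Suc l)
  show ?case
  proof (cases l)
    case 0
    then show ?thesis by (simp add: brace_ideal_iff subgroup_self)
  next
    case l: (Suc k)
    let ?G = "\<Union>a \<in> carrier A. \<Union>u \<in> lower_central A (Suc k). {star A a u, star A u a, commutator A a u}"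
    have sub: "subgroup (lower_central A (Suc k)) A"
      using Suc unfolding l by (rule ideal_subgroup)
    then have car: "lower_central A (Suc k) \<subseteq> carrier A" by (rule subgroup.subset)
    have "apply_symb A e a u \<in> lower_central A (Suc k)"
      if "a \<in> carrier A" "u \<in> lower_central A (Suc k)" for e a u
      using ideal_absorbs[OF Suc[unfolded l]] that .
    from this[of _ _ Star] this[of _ _ StarBar] this[of _ _ Gam]
    have "?G \<subseteq> lower_central A (Suc k)" by auto
    then have le: "lower_central A (Suc (Suc k)) \<subseteq> lower_central A (Suc k)"
      using generate_subgroup_incl[OF _ sub] by simp
    have "?G \<subseteq> carrier A" using car by auto
    then have "subgroup (lower_central A (Suc (Suc k))) A"
      using generate_is_subgroup by simp
    then show ?thesis
      unfolding l brace_ideal_iff using lower_central_step[OF _ _ car] le by blast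
  qed
qed

lemma word_val_lower_central:
  "as \<in> tuples A (length m + 1) \<Longrightarrow> word_val A m as \<in> lower_central A (Suc (length m))"
proof (induction m arbitrary: as)
  case Nil
  then show ?case by (auto simp: tuples_def length_Suc_conv)
next
  case (Cons e m)
  then obtain a as' where as: "as = a # as'" "a \<in> carrier A" "as' \<in> tuples A (length m + 1)"
    by (auto simp: tuples_def length_Suc_conv)
  have "apply_symb A e a (word_val A m as') \<in> lower_central A (Suc (Suc (length m)))"
    by (rule lower_central_step[OF as(2) Cons.IH[OF as(3)]])
      (rule subgroup.subset[OF ideal_subgroup[OF lower_central_ideal]])
  then show ?case by (simp add: as(1))
qed

lemma verbal_le_lower_central: "verbal A k \<subseteq> lower_central A (k + 1)"
  unfolding verbal_eq
  by (rule generate_subgroup_incl[OF _ ideal_subgroup[OF lower_central_ideal]])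
    (auto intro: word_val_lower_central[simplified])

text \<open>Words of degree \<open>n\<close> take their values in \<open>\<Gamma>\<^sub>n\<^sub>+\<^sub>1\<close>: this quotient is the nilpotent factor whose
  presence in a product does not affect isoclinism.\<close>

lemma verbal_quotient_trivial:
  "verbal (quotient_brace A (lower_central A (n + 1))) n = {lower_central A (n + 1)}"
proof -
  let ?G = "lower_central A (n + 1)"
  have G: "brace_ideal ?G A" by (rule lower_central_ideal)
  interpret p: brace_morphism A "quotient_brace A ?G" "\<lambda>a. ?G #> a"
    using coset_hom[OF G] skew_brace_quotient[OF G] by unfold_locales
  have "verbal (quotient_brace A ?G) n = (\<lambda>a. ?G #> a) ` verbal A n"
    by (rule p.verbal_image[symmetric]) (rule carrier_quotient[symmetric])
  also have "\<dots> \<subseteq> {?G}"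
    using verbal_le_lower_central[of n] coset_eq_self[OF ideal_subgroup[OF G]] verbal_closed by auto
  finally show ?thesis
    using subgroup.one_closed[OF p.B.verbal_subgroup[of n]] by (auto simp: quotient_brace_def)
qed

end

locale symmetric_brace = skew_brace_ops +
  assumes swap_brace: "skew_brace (swap A)"

context symmetric_brace
begin

text \<open>The law of the swapped brace turns \<open>\<lambda>\<close>, a homomorphism on \<open>(A,\<circ>)\<close>, into an anti-homomorphism on
  \<open>(A,\<cdot>)\<close>: compare the two evaluations of \<open>x \<cdot> (y \<circ> z)\<close>.\<close>

lemma lam_mult_left:
  assumes "a \<in> carrier A" "b \<in> carrier A" "c \<in> carrier A"
  shows "lam A (a \<otimes> b) c = lam A b (lam A a c)"
proof -
  have rev: "lam A (x \<otimes> y) (lam A (cinv x) z) = lam A y z"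
    if "x \<in> carrier A" "y \<in> carrier A" "z \<in> carrier A" for x y z
  proof -
    have "x \<otimes> (y \<odot> z) = (x \<otimes> y) \<odot> cinv x \<odot> (x \<otimes> z)"
      using swap_brace that by (simp add: skew_brace_def)
    also have "\<dots> = (x \<otimes> y) \<odot> (cinv x \<odot> (x \<otimes> z))"
      using that by (simp add: circ.m_assoc)
    also have "cinv x \<odot> (x \<otimes> z) = lam A (cinv x) z"
      using that by (simp add: mult_eq_circ_lam flip: circ.m_assoc)
    finally have "x \<otimes> y \<otimes> lam A y z = x \<otimes> y \<otimes> lam A (x \<otimes> y) (lam A (cinv x) z)"
      using that by (simp add: circ_eq_mult_lam m_assoc)
    then show ?thesis using that by (simp add: m_assoc)
  qed
  show ?thesis
    using rev[of a b "lam A a c"] assms by (simp add: lam_cinv)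
qed

text \<open>Commutation with \<open>a\<close> turns a product \<open>u\<cdot>v\<close> into a product of commutations of \<open>u\<close> and \<open>v\<close> with \<open>a\<close>,
  up to conjugation and \<open>\<lambda>\<close>; for \<open>(u\<cdot>v) * a\<close> this is where the symmetry enters. As the next
  verbal subgroup is normal and stable under \<open>\<lambda>\<close>, the elements \<open>u\<close> whose commutations all lie in
  it form a subgroup, and it suffices to test the words that generate.\<close>

lemma apply_symb_verbal:
  assumes "u \<in> verbal A k" "a \<in> carrier A"
  shows "apply_symb A e a u \<in> verbal A (Suc k)"
proof -
  let ?V = "verbal A (Suc k)"
  note V = subgroup.one_closed[OF verbal_subgroup] subgroup.m_closed[OF verbal_subgroup]
    subgroup.m_inv_closed[OF verbal_subgroup]
  \<comment> \<open>The symbol for \<open>[u,a]\<close> is left out, being the inverse of \<open>[a,u]\<close>.\<close>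
  define W where
    "W = {u \<in> carrier A. \<forall>a \<in> carrier A. star A a u \<in> ?V \<and> star A u a \<in> ?V \<and> commutator A a u \<in> ?V}"
  have "subgroup W A"
  proof (rule subgroup.intro)
    fix u v assume "u \<in> W" "v \<in> W"
    then have u: "u \<in> carrier A" "\<And>a. a \<in> carrier A \<Longrightarrow> star A a u \<in> ?V \<and> star A u a \<in> ?V \<and> commutator A a u \<in> ?V"
      and v: "v \<in> carrier A" "\<And>a. a \<in> carrier A \<Longrightarrow> star A a v \<in> ?V \<and> star A v a \<in> ?V \<and> commutator A a v \<in> ?V"
      by (auto simp: W_def)
    have "star A a (u \<otimes> v) \<in> ?V \<and> star A (u \<otimes> v) a \<in> ?V \<and> commutator A a (u \<otimes> v) \<in> ?V"
      if a: "a \<in> carrier A" for a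
    proof -
      have "star A a (u \<otimes> v) = star A a u \<otimes> (u \<otimes> star A a v \<otimes> inv u)"
        using u(1) v(1) a by (simp add: star_def lam_mult group_simps)
      moreover have "star A (u \<otimes> v) a = lam A v (star A u a) \<otimes> star A v a"
        using u(1) v(1) a by (simp add: star_def lam_mult_left lam_mult lam_inv group_simps)
      moreover have "commutator A a (u \<otimes> v) = commutator A a u \<otimes> (u \<otimes> commutator A a v \<otimes> inv u)"
        using u(1) v(1) a by (simp add: commutator_def group_simps)
      ultimately show ?thesis
        using u v a V verbal_stable by simp
    qed
    then show "u \<otimes> v \<in> W" using u(1) v(1) by (simp add: W_def)
  next
    fix u assume "u \<in> W"
    then have u: "u \<in> carrier A" "\<And>a. a \<in> carrier A \<Longrightarrow> star A a u \<in> ?V \<and> star A u a \<in> ?V \<and> commutator A a u \<in> ?V"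
      by (auto simp: W_def)
    have "star A a (inv u) \<in> ?V \<and> star A (inv u) a \<in> ?V \<and> commutator A a (inv u) \<in> ?V"
      if a: "a \<in> carrier A" for a
    proof -
      have "star A a (inv u) = inv u \<otimes> inv (star A a u) \<otimes> inv (inv u)"
        using u(1) a by (simp add: star_def lam_inv group_simps)
      moreover have "lam A (inv u) (lam A u a) = a"
        using u(1) a by (simp flip: lam_mult_left)
      then have "star A (inv u) a = lam A (inv u) (inv (star A u a))"
        using u(1) a by (simp add: star_def inv_mult_group lam_mult lam_inv)
      moreover have "commutator A a (inv u) = inv u \<otimes> inv (commutator A a u) \<otimes> inv (inv u)"
        using u(1) a by (simp add: commutator_def group_simps)
      ultimately show ?thesis
        using u a V verbal_stable[of "inv u"] by simp
    qed
    then show "inv u \<in> W" using u(1) by (simp add: W_def)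
  qed (use V in \<open>auto simp: W_def star_def commutator_def\<close>)
  moreover have "{word_val A m as | m as. length m = k \<and> as \<in> tuples A (k + 1)} \<subseteq> W"
  proof (clarify)
    fix m :: "symb list" and as assume as: "as \<in> tuples A (length m + 1)" "k = length m"
    have "apply_symb A e a (word_val A m as) \<in> ?V" if "a \<in> carrier A" for e a
      using apply_symb_word[OF that as(1)] as(2) by simp
    from this[of _ Star] this[of _ StarBar] this[of _ Gam]
    show "word_val A m as \<in> W" using as by (simp add: W_def)
  qed
  ultimately have "verbal A k \<subseteq> W"
    unfolding verbal_eq[of k] by (rule generate_subgroup_incl[rotated])
  with assms have *: "star A a u \<in> ?V" "star A u a \<in> ?V" "commutator A a u \<in> ?V" "u \<in> carrier A"
    by (auto simp: W_def)
  then have "commutator A u a \<in> ?V"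
    using V(3)[of "commutator A a u"] assms(2) by (simp add: inv_commutator)
  with * show ?thesis by (cases e) simp_all
qed

lemma lower_central_le_verbal: "lower_central A (Suc k) \<subseteq> verbal A k"
proof (induction k)
  case 0
  have "a \<in> verbal A 0" if "a \<in> carrier A" for a
    using word_val_verbal[of 0 "[]" "[a]"] that by (simp add: tuples_def)
  then show ?case by auto
next
  case (Suc k)
  then have "apply_symb A e a u \<in> verbal A (Suc k)"
    if "a \<in> carrier A" "u \<in> lower_central A (Suc k)" for e a u
    using that apply_symb_verbal by blast
  from this[of _ _ Star] this[of _ _ StarBar] this[of _ _ Gam] show ?case
    by (auto intro!: generate_subgroup_incl[OF _ verbal_subgroup] simp del: lower_central.simps(1,2))
qed

end

section \<open>Isoclinic products and quotients\<close>

lemma isoclinic_class: "isoclinic n A B \<Longrightarrow> in_class_I n A" "isoclinic n A B \<Longrightarrow> in_class_I n B"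
  by (simp_all add: isoclinic_def)

lemma isoclinic_iso:
  assumes "skew_brace A" "skew_brace B" "h \<in> brace_iso A B" "in_class_I n A \<or> in_class_I n B"
  shows "isoclinic n A B"
proof -
  interpret h: brace_morphism A B h
    using assms(1,2) brace_isoE(1)[OF assms(3)] by unfold_locales
  show ?thesis
  proof (rule h.isoclinic_surjection[OF brace_isoE(2)[OF assms(3)] _ assms(4)])
    fix x assume "x \<in> verbal A n" "h x = \<one>\<^bsub>B\<^esub>"
    then show "x = \<one>\<^bsub>A\<^esub>"
      using inj_onD[OF brace_isoE(3)[OF assms(3)], of x "\<one>\<^bsub>A\<^esub>"] by (simp add: h.A.verbal_closed)
  qed
qed

text \<open>Since words of degree \<open>n\<close> vanish in the second factor, an element of the verbal subgroup of the
  product is determined by its first component.\<close>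

lemma isoclinic_prod:
  assumes A: "skew_brace A" and D: "skew_brace D" and triv: "verbal D n = {\<one>\<^bsub>D\<^esub>}"
    and cls: "in_class_I n (prod_brace A D) \<or> in_class_I n A"
  shows "isoclinic n (prod_brace A D) A"
proof -
  interpret p: brace_morphism "prod_brace A D" A fst
    using A skew_brace_prod[OF A D] proj_hom by unfold_locales
  interpret q: brace_morphism "prod_brace A D" D snd
    using D skew_brace_prod[OF A D] proj_hom by unfold_locales
  have surj: "fst ` carrier (prod_brace A D) = carrier A" "snd ` carrier (prod_brace A D) = carrier D"
    using p.B.one_closed q.B.one_closed by (force simp: image_iff)+
  show ?thesis
  proof (rule p.isoclinic_surjection[OF surj(1) _ cls])
    fix x assume x: "x \<in> verbal (prod_brace A D) n" "fst x = \<one>\<^bsub>A\<^esub>"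
    then have "snd x = \<one>\<^bsub>D\<^esub>"
      using q.verbal_image[OF surj(2), of n] triv by blast
    then show "x = \<one>\<^bsub>prod_brace A D\<^esub>" using x(2) by (simp add: prod_eq_iff)
  qed
qed

lemma isoclinic_prod_quot:
  assumes C: "skew_brace C" and N: "brace_ideal N C"
    and cls: "in_class_I n (prod_quot n C N) \<or> in_class_I n (quotient_brace C N)"
  shows "isoclinic n (prod_quot n C N) (quotient_brace C N)"
proof -
  interpret skew_brace_ops C using C by unfold_locales
  show ?thesis
  proof (rule isoclinic_prod[OF skew_brace_quotient[OF N] skew_brace_quotient _ cls])
    show "brace_ideal (lower_central C (n + 1)) C" by (rule lower_central_ideal)
    show "verbal (quotient_brace C (lower_central C (n + 1))) n =
        {\<one>\<^bsub>quotient_brace C (lower_central C (n + 1))\<^esub>}"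
      using verbal_quotient_trivial[of n] by (simp add: quotient_brace_def[of C])
  qed
qed

lemma (in brace_morphism) iso_quotient_kernel:
  assumes surj: "f ` carrier A = carrier B"
  shows "B \<cong>\<^sub>b quotient_brace A {a \<in> carrier A. f a = \<one>\<^bsub>B\<^esub>}"
proof -
  let ?K = "{a \<in> carrier A. f a = \<one>\<^bsub>B\<^esub>}"
  have K: "?K #>\<^bsub>A\<^esub> c = ?K #>\<^bsub>A\<^esub> d \<longleftrightarrow> f c = f d" if "c \<in> carrier A" "d \<in> carrier A" for c d
  proof -
    have "?K #>\<^bsub>A\<^esub> c = ?K #>\<^bsub>A\<^esub> d \<longleftrightarrow> f c \<otimes>\<^bsub>B\<^esub> inv\<^bsub>B\<^esub> f d = \<one>\<^bsub>B\<^esub>"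
      using that A.coset_eq_iff[OF A.ideal_subgroup[OF kernel_ideal]] by simp
    also have "\<dots> \<longleftrightarrow> f c = f d"
      using that by (metis B.inv_closed B.inv_equality B.inv_inv B.r_inv hom_closed)
    finally show ?thesis .
  qed
  obtain h where "h \<in> brace_iso B (quotient_brace A ?K)"
    by (rule iso_of_same_fibres[of A f B "\<lambda>a. ?K #>\<^bsub>A\<^esub> a" "quotient_brace A ?K"])
      (use surj hom A.coset_hom[OF kernel_ideal] A.carrier_quotient K in auto)
  then show ?thesis by (auto simp: brace_isomorphic_def)
qed

lemma image_sub_skew_brace:
  assumes "skew_brace A" "skew_brace B" "f \<in> brace_hom A B"
  shows "sub_skew_brace (f ` carrier A) B"
proof -
  interpret A: skew_brace_ops A by unfold_locales fact
  interpret B: skew_brace_ops B by unfold_locales fact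
  interpret f: group_hom A B f using assms(3) by unfold_locales (simp add: brace_hom_def)
  have "group_hom (swap A) (swap B) f"
    using assms(3) by (intro group_hom.intro group_hom_axioms.intro A.circ.is_group B.circ.is_group)
      (simp add: brace_hom_def)
  from group_hom.img_is_subgroup[OF this] f.img_is_subgroup show ?thesis
    by (simp add: sub_skew_brace_def)
qed

context symmetric_brace
begin

context
  fixes N n
  assumes N: "brace_ideal N A" and inter: "N \<inter> verbal A n = {\<one>}" and cls: "in_class_I n A"
begin

lemma isoclinic_quotient: "isoclinic n A (quotient_brace A N)"
proof -
  interpret p: brace_morphism A "quotient_brace A N" "\<lambda>a. N #> a"
    using coset_hom[OF N] skew_brace_quotient[OF N] by unfold_locales
  show ?thesis
  proof (rule p.isoclinic_surjection)
    fix x assume x: "x \<in> verbal A n" "N #> x = \<one>\<^bsub>quotient_brace A N\<^esub>"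
    then have "x \<in> N"
      using coset_eq_self[OF ideal_subgroup[OF N]] verbal_closed by (simp add: quotient_brace_def)
    with x(1) inter show "x = \<one>" by blast
  qed (use cls in \<open>simp_all add: carrier_quotient\<close>)
qed

lemma isoclinic_to_product: "isoclinic n A (prod_quot n A N)"
proof -
  have "in_class_I n (quotient_brace A N)"
    by (rule isoclinic_class(2)[OF isoclinic_quotient])
  then have "isoclinic n (prod_quot n A N) (quotient_brace A N)"
    using isoclinic_prod_quot[OF skew_brace N] by blast
  then show ?thesis using isoclinic_trans[OF isoclinic_quotient] isoclinic_sym by blast
qed

text \<open>The two projections embed the brace in the product because \<open>N\<close> meets \<open>\<Gamma>\<^sub>n\<^sub>+\<^sub>1\<close> trivially, and this
  in turn holds because \<open>\<Gamma>\<^sub>n\<^sub>+\<^sub>1\<close> is contained in the verbal subgroup.\<close>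

lemma embeds_in_product:
  obtains H where "sub_skew_brace H (prod_quot n A N)"
    "A \<cong>\<^sub>b restrict_brace (prod_quot n A N) H" "restrict_brace (prod_quot n A N) H \<cong>\<^sub>b A"
proof -
  let ?G = "lower_central A (n + 1)" and ?P = "prod_quot n A N"
  define e where "e a = (N #> a, ?G #> a)" for a
  note G = lower_central_ideal[of "n + 1"]
  have e: "e \<in> brace_hom A ?P"
    using coset_hom[OF N] coset_hom[OF G] by (simp add: brace_hom_iff e_def)
  have P: "skew_brace ?P"
    using skew_brace_prod[OF skew_brace_quotient[OF N] skew_brace_quotient[OF G]] .
  have inj: "e c = e d \<longleftrightarrow> c = d" if "c \<in> carrier A" "d \<in> carrier A" for c d
  proof
    assume "e c = e d"
    then have "c \<otimes> inv d \<in> N" "c \<otimes> inv d \<in> ?G"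
      using that coset_eq_iff[OF ideal_subgroup[OF N]] coset_eq_iff[OF ideal_subgroup[OF G]]
      by (simp_all add: e_def)
    then have "c \<otimes> inv d = \<one>" using lower_central_le_verbal[of n] inter by auto
    then show "c = d" using that by (metis inv_closed inv_equality inv_inv)
  qed simp
  let ?R = "restrict_brace ?P (e ` carrier A)"
  have e': "e \<in> brace_hom A ?R" "e ` carrier A = carrier ?R"
    using e by (simp_all add: brace_hom_iff)
  have id: "(\<lambda>a. a) \<in> brace_hom A A" by (simp add: brace_hom_iff)
  obtain h where "h \<in> brace_iso A ?R"
    by (rule iso_of_same_fibres[of A "\<lambda>a. a" A e ?R]) (use e' id inj in auto)
  moreover obtain g where "g \<in> brace_iso ?R A"
    by (rule iso_of_same_fibres[of A e ?R "\<lambda>a. a" A]) (use e' id inj in auto)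
  ultimately show thesis
    using that image_sub_skew_brace[OF skew_brace P e] unfolding brace_isomorphic_def by blast
qed

end

end

section \<open>The fibre product of two isoclinic braces\<close>

lemma equalizer_subgroup:
  assumes "group_hom G H f" "group_hom G H g"
  shows "subgroup {x \<in> carrier G. f x = g x} G"
proof -
  interpret f: group_hom G H f by fact
  interpret g: group_hom G H g by fact
  show ?thesis by (rule subgroup.intro) auto
qed

lemma equalizer_sub_skew_brace:
  assumes A: "skew_brace A" and B: "skew_brace B" and f: "f \<in> brace_hom A B" and g: "g \<in> brace_hom A B"
  shows "sub_skew_brace {x \<in> carrier A. f x = g x} A"
proof -
  have "group_hom A B h" "group_hom (swap A) (swap B) h" if "h \<in> brace_hom A B" for h
    using A B that by (auto simp: skew_brace_def brace_hom_def intro!: group_hom.intro group_hom_axioms.intro)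
  then have "subgroup {x \<in> carrier A. f x = g x} A"
    "subgroup {x \<in> carrier (swap A). f x = g x} (swap A)"
    using f g by (blast intro: equalizer_subgroup)+
  then show ?thesis by (simp add: sub_skew_brace_def)
qed

lemma swap_swap [simp]: "swap (swap A) = A"
  by (simp add: swap_def)

text \<open>The pairs whose cosets correspond under \<open>\<xi>\<close>. The last property is the compatibility of \<open>\<theta>\<close> with
  the words: it places the verbal subgroup of the fibre product inside the graph of the injective map
  \<open>\<theta>\<close>, so that neither projection has a nontrivial kernel on it.\<close>

lemma fibre_product:
  assumes A: "symmetric_skew_brace A" and B: "symmetric_skew_brace B" and iso: "isoclinic n A B"
  obtains C :: "('a \<times> 'b) brace" where "symmetric_skew_brace C"
    "fst \<in> brace_hom C (A :: 'a brace)" "snd \<in> brace_hom C (B :: 'b brace)"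
    "fst ` carrier C = carrier A" "snd ` carrier C = carrier B"
    "\<one>\<^bsub>C\<^esub> = (\<one>\<^bsub>A\<^esub>, \<one>\<^bsub>B\<^esub>)"
    "\<forall>x \<in> verbal C n. fst x = \<one>\<^bsub>A\<^esub> \<longleftrightarrow> snd x = \<one>\<^bsub>B\<^esub>"
proof -
  have cls: "in_class_I n A" "in_class_I n B" using isoclinic_class[OF iso] .
  interpret A: skew_brace_ops A using A by unfold_locales (simp add: symmetric_skew_brace_def)
  interpret B: skew_brace_ops B using B by unfold_locales (simp add: symmetric_skew_brace_def)
  obtain \<xi> \<theta> where \<xi>: "\<xi> \<in> brace_iso (quot_ann A n) (quot_ann B n)"
    and \<theta>: "\<theta> \<in> brace_iso (restrict_brace A (verbal A n)) (restrict_brace B (verbal B n))"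
    and phi: "\<And>m Xs. length m = n \<Longrightarrow> Xs \<in> tuples (quot_ann A n) (n + 1) \<Longrightarrow>
      \<theta> (phi A n m Xs) = phi B n m (map \<xi> Xs)"
    using iso by (auto simp: isoclinic_def)
  let ?p = "\<lambda>a. upper_ann A n #>\<^bsub>A\<^esub> a" and ?q = "\<lambda>b. upper_ann B n #>\<^bsub>B\<^esub> b"
  let ?P = "prod_brace A B"
  define R where "R = {x \<in> carrier ?P. (\<xi> \<circ> ?p \<circ> fst) x = (?q \<circ> snd) x}"
  define C where "C = restrict_brace ?P R"
  note p = A.coset_hom[OF A.upper_ann_ideal[of n]] and q = B.coset_hom[OF B.upper_ann_ideal[of n]]
  have P: "skew_brace ?P" by (rule skew_brace_prod[OF A.skew_brace B.skew_brace])
  have R: "sub_skew_brace R ?P"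
    unfolding R_def
  proof (rule equalizer_sub_skew_brace[OF P])
    show "skew_brace (quot_ann B n)" by (rule B.skew_brace_quotient[OF B.upper_ann_ideal])
    show "\<xi> \<circ> ?p \<circ> fst \<in> brace_hom ?P (quot_ann B n)"
      by (rule brace_hom_compose[OF proj_hom(1) brace_hom_compose[OF p brace_isoE(1)[OF \<xi>]]])
    show "?q \<circ> snd \<in> brace_hom ?P (quot_ann B n)"
      by (rule brace_hom_compose[OF proj_hom(2) q])
  qed
  have C_brace: "skew_brace C" unfolding C_def by (rule skew_brace_restrict[OF P R])
  have "skew_brace (swap ?P)"
    using A B unfolding swap_prod symmetric_skew_brace_def by (blast intro: skew_brace_prod)
  moreover have "sub_skew_brace R (swap ?P)"
    using R unfolding sub_skew_brace_def swap_swap by blast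
  ultimately have "skew_brace (swap C)"
    unfolding C_def swap_restrict by (rule skew_brace_restrict)
  with C_brace have sym: "symmetric_skew_brace C" by (simp add: symmetric_skew_brace_def)
  have carrier_C: "carrier C = R" by (simp add: C_def)
  have R_iff: "x \<in> R \<longleftrightarrow> fst x \<in> carrier A \<and> snd x \<in> carrier B \<and> \<xi> (?p (fst x)) = ?q (snd x)" for x
    by (cases x) (auto simp: R_def)
  have homs: "fst \<in> brace_hom C A" "snd \<in> brace_hom C B"
    using proj_hom[of A B] by (auto simp: C_def brace_hom_iff R_def)
  have surj_fst: "fst ` carrier C = carrier A"
  proof (intro subset_antisym subsetI)
    fix a assume a: "a \<in> carrier A"
    then have "\<xi> (?p a) \<in> ?q ` carrier B"
      using brace_isoE(2)[OF \<xi>] by (auto simp flip: B.carrier_quotient simp: A.carrier_quotient)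
    then obtain b where "b \<in> carrier B" "\<xi> (?p a) = ?q b" by blast
    with a show "a \<in> fst ` carrier C"
      unfolding carrier_C by (intro image_eqI[of _ _ "(a, b)"]) (simp_all add: R_iff)
  qed (auto simp: carrier_C R_iff)
  have surj_snd: "snd ` carrier C = carrier B"
  proof (intro subset_antisym subsetI)
    fix b assume b: "b \<in> carrier B"
    then have "?q b \<in> \<xi> ` ?p ` carrier A"
      using brace_isoE(2)[OF \<xi>] by (simp flip: A.carrier_quotient add: B.carrier_quotient)
    then obtain a where "a \<in> carrier A" "\<xi> (?p a) = ?q b" by auto
    with b show "b \<in> snd ` carrier C"
      unfolding carrier_C by (intro image_eqI[of _ _ "(a, b)"]) (simp_all add: R_iff)
  qed (auto simp: carrier_C R_iff)
  interpret f: brace_morphism C A fst using homs C_brace by unfold_locales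
  interpret s: brace_morphism C B snd using homs C_brace by unfold_locales
  have \<theta>_mult: "\<theta> (x \<otimes>\<^bsub>A\<^esub> y) = \<theta> x \<otimes>\<^bsub>B\<^esub> \<theta> y" if "x \<in> verbal A n" "y \<in> verbal A n" for x y
    using brace_isoE(1)[OF \<theta>] that by (simp add: brace_hom_iff)
  have \<theta>_closed: "\<theta> x \<in> carrier B" if "x \<in> verbal A n" for x
    using brace_isoE(1)[OF \<theta>] that B.verbal_closed[of "\<theta> x" n] by (simp add: brace_hom_iff)
  note V = subgroup.one_closed[OF A.verbal_subgroup] subgroup.m_closed[OF A.verbal_subgroup]
    subgroup.m_inv_closed[OF A.verbal_subgroup]
  have \<theta>_one: "\<theta> \<one>\<^bsub>A\<^esub> = \<one>\<^bsub>B\<^esub>"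
  proof -
    have "\<theta> \<one>\<^bsub>A\<^esub> \<otimes>\<^bsub>B\<^esub> \<theta> \<one>\<^bsub>A\<^esub> = \<theta> \<one>\<^bsub>A\<^esub>" using V by (simp flip: \<theta>_mult)
    then show ?thesis using \<theta>_closed[OF V(1)] by simp
  qed
  have \<theta>_inv: "\<theta> (inv\<^bsub>A\<^esub> x) = inv\<^bsub>B\<^esub> (\<theta> x)" if "x \<in> verbal A n" for x
  proof -
    have "\<theta> (inv\<^bsub>A\<^esub> x) \<otimes>\<^bsub>B\<^esub> \<theta> x = \<one>\<^bsub>B\<^esub>"
      using that V A.verbal_closed[OF that] by (simp flip: \<theta>_mult add: \<theta>_one)
    then show ?thesis using \<theta>_closed that V by (simp add: B.inv_equality)
  qed
  \<comment> \<open>The isoclinism condition, read at the cosets of the first coordinates, whose images under \<open>\<xi>\<close> are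
    the cosets of the second ones.\<close>
  have graph_word: "fst x \<in> verbal A n \<and> \<theta> (fst x) = snd x \<and> x \<in> carrier C"
    if x_word: "x \<in> {word_val C m as | m as. length m = n \<and> as \<in> tuples C (n + 1)}" for x
  proof -
    obtain m as where m: "length m = n" and as: "as \<in> tuples C (n + 1)" and x: "x = word_val C m as"
      using x_word by auto
    have fx: "fst x = word_val A m (map fst as)" and sx: "snd x = word_val B m (map snd as)"
      using f.hom_word_val[of as m] s.hom_word_val[of as m] m as x by (auto simp: tuples_def)
    have "map \<xi> (coset_tuple A n (map fst as)) = coset_tuple B n (map snd as)"
      using as unfolding coset_tuple_def map_map
      by (intro map_cong) (auto simp only: tuples_def carrier_C subset_iff R_iff comp_def mem_Collect_eq)
    moreover have "phi A n m (coset_tuple A n (map fst as)) = fst x"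
      using A.phi_coset_tuple[of n m "map fst as"] cls(1) m f.map_tuples[OF as] fx
      by (simp add: in_class_I_def)
    moreover have "phi B n m (coset_tuple B n (map snd as)) = snd x"
      using B.phi_coset_tuple[of n m "map snd as"] cls(2) m s.map_tuples[OF as] sx
      by (simp add: in_class_I_def)
    ultimately have "\<theta> (fst x) = snd x"
      using phi[OF m A.coset_tuple_closed[OF f.map_tuples[OF as]]] by simp
    moreover have "fst x \<in> verbal A n"
      unfolding fx using f.map_tuples[OF as] m by (intro A.word_val_verbal) auto
    moreover have "x \<in> carrier C" using x as m by simp
    ultimately show ?thesis by simp
  qed
  have graph: "fst x \<in> verbal A n \<and> \<theta> (fst x) = snd x" if "x \<in> verbal C n" for x
    using that[unfolded f.A.verbal_eq]
  proof (induction rule: generate.induct)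
    case one
    then show ?case using V by (simp add: \<theta>_one)
  next
    case (incl x)
    then show ?case using graph_word by blast
  next
    case (inv x)
    then show ?case using graph_word[OF inv] V by (simp add: \<theta>_inv)
  next
    case (eng x y)
    then have xy: "x \<in> carrier C" "y \<in> carrier C"
      using f.A.verbal_closed unfolding f.A.verbal_eq by blast+
    then show ?case using eng.IH V by (simp add: \<theta>_mult)
  qed
  show thesis
  proof (rule that[OF sym homs surj_fst surj_snd])
    show "\<one>\<^bsub>C\<^esub> = (\<one>\<^bsub>A\<^esub>, \<one>\<^bsub>B\<^esub>)" by (simp add: C_def)
    show "\<forall>x \<in> verbal C n. fst x = \<one>\<^bsub>A\<^esub> \<longleftrightarrow> snd x = \<one>\<^bsub>B\<^esub>"
    proof
      fix x assume x: "x \<in> verbal C n"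
      then have "fst x = \<one>\<^bsub>A\<^esub> \<longleftrightarrow> \<theta> (fst x) = \<theta> \<one>\<^bsub>A\<^esub>"
        using inj_on_eq_iff[OF brace_isoE(3)[OF \<theta>], of "fst x" "\<one>\<^bsub>A\<^esub>"] graph V by simp
      then show "fst x = \<one>\<^bsub>A\<^esub> \<longleftrightarrow> snd x = \<one>\<^bsub>B\<^esub>" using graph[OF x] \<theta>_one by simp
    qed
  qed
qed

section \<open>Isoclinic braces and their common covers\<close>

lemma isoclinic_common_cover:
  assumes "symmetric_skew_brace (A :: 'a brace)" "symmetric_skew_brace (B :: 'b brace)" "isoclinic n A B"
  obtains C :: "('a \<times> 'b) brace" and N\<^sub>1 N\<^sub>2 C\<^sub>A C\<^sub>B where "common_cover A B C N\<^sub>1 N\<^sub>2"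
    "isoclinic_to_both n A B C" "isoclinic_to_products n C N\<^sub>1 N\<^sub>2 C\<^sub>A C\<^sub>B"
proof -
  obtain C :: "('a \<times> 'b) brace" where C: "symmetric_skew_brace C"
    and homs: "fst \<in> brace_hom C A" "snd \<in> brace_hom C B"
    and surj: "fst ` carrier C = carrier A" "snd ` carrier C = carrier B"
    and one: "\<one>\<^bsub>C\<^esub> = (\<one>\<^bsub>A\<^esub>, \<one>\<^bsub>B\<^esub>)"
    and graph: "\<forall>x \<in> verbal C n. fst x = \<one>\<^bsub>A\<^esub> \<longleftrightarrow> snd x = \<one>\<^bsub>B\<^esub>"
    by (rule fibre_product[OF assms])
  have A: "skew_brace A" and B: "skew_brace B"
    using assms(1,2) by (simp_all add: symmetric_skew_brace_def)
  interpret C: symmetric_brace C using C by unfold_locales (simp_all add: symmetric_skew_brace_def)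
  interpret f: brace_morphism C A fst using homs A by unfold_locales
  interpret s: brace_morphism C B snd using homs B by unfold_locales
  have trivial: "x = \<one>\<^bsub>C\<^esub>" if "x \<in> verbal C n" "fst x = \<one>\<^bsub>A\<^esub> \<or> snd x = \<one>\<^bsub>B\<^esub>" for x
  proof -
    have "fst x = \<one>\<^bsub>A\<^esub>" "snd x = \<one>\<^bsub>B\<^esub>" using that graph by blast+
    then show ?thesis by (simp add: one prod_eq_iff)
  qed
  have cls_AB: "in_class_I n A" "in_class_I n B" using isoclinic_class[OF assms(3)] .
  have CA: "isoclinic n C A"
    by (rule f.isoclinic_surjection[OF surj(1) _ disjI2[OF cls_AB(1)]]) (simp add: trivial)
  have CB: "isoclinic n C B"
    by (rule s.isoclinic_surjection[OF surj(2) _ disjI2[OF cls_AB(2)]]) (simp add: trivial)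
  note cls = isoclinic_class(1)[OF CA]
  define N\<^sub>1 where "N\<^sub>1 = {c \<in> carrier C. snd c = \<one>\<^bsub>B\<^esub>}"
  define N\<^sub>2 where "N\<^sub>2 = {c \<in> carrier C. fst c = \<one>\<^bsub>A\<^esub>}"
  have N: "brace_ideal N\<^sub>1 C" "brace_ideal N\<^sub>2 C"
    unfolding N\<^sub>1_def N\<^sub>2_def by (rule s.kernel_ideal f.kernel_ideal)+
  have cover: "common_cover A B C N\<^sub>1 N\<^sub>2"
    using f.iso_quotient_kernel[OF surj(1)] s.iso_quotient_kernel[OF surj(2)] C.skew_brace N
    by (simp add: common_cover_def N\<^sub>1_def N\<^sub>2_def)
  have inter: "N\<^sub>1 \<inter> verbal C n = {\<one>\<^bsub>C\<^esub>}" "N\<^sub>2 \<inter> verbal C n = {\<one>\<^bsub>C\<^esub>}"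
    using trivial subgroup.one_closed[OF C.verbal_subgroup[of n]]
      f.hom_one s.hom_one C.one_closed unfolding N\<^sub>1_def N\<^sub>2_def by blast+
  obtain C\<^sub>B where C\<^sub>B: "sub_skew_brace C\<^sub>B (prod_quot n C N\<^sub>2)"
    "restrict_brace (prod_quot n C N\<^sub>2) C\<^sub>B \<cong>\<^sub>b C"
    by (rule C.embeds_in_product[OF N(2) inter(2) cls])
  obtain C\<^sub>A where C\<^sub>A: "sub_skew_brace C\<^sub>A (prod_quot n C N\<^sub>1)"
    "C \<cong>\<^sub>b restrict_brace (prod_quot n C N\<^sub>1) C\<^sub>A"
    by (rule C.embeds_in_product[OF N(1) inter(1) cls])
  have "isoclinic_to_products n C N\<^sub>1 N\<^sub>2 C\<^sub>A C\<^sub>B"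
    unfolding isoclinic_to_products_def
    using C\<^sub>A C\<^sub>B C.isoclinic_to_product[OF N(1) inter(1) cls] C.isoclinic_to_product[OF N(2) inter(2) cls]
    by blast
  moreover have "isoclinic_to_both n A B C" using CA CB by (simp add: isoclinic_to_both_def)
  ultimately show thesis using cover that by blast
qed

text \<open>The product is isoclinic to its first factor \<open>C/N\<close>, a copy of one of the two given braces; transitivity
  does the rest.\<close>

lemma products_isoclinic_to_both:
  assumes A: "skew_brace A" and B: "skew_brace B" and cover: "common_cover A B C N\<^sub>1 N\<^sub>2"
    and prods: "isoclinic_to_products n C N\<^sub>1 N\<^sub>2 C\<^sub>A C\<^sub>B"
  shows "isoclinic_to_both n A B C"
proof -
  have C: "skew_brace C" using cover by (simp add: common_cover_def)
  interpret skew_brace_ops C using C by unfold_locales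
  have "isoclinic n C D"
    if N: "brace_ideal N C" and D: "skew_brace D" "D \<cong>\<^sub>b quotient_brace C N"
      and iso: "isoclinic n C (prod_quot n C N)" for D N
  proof -
    have quot: "isoclinic n (prod_quot n C N) (quotient_brace C N)"
      using isoclinic_prod_quot[OF C N] isoclinic_class(2)[OF iso] by blast
    obtain h where "h \<in> brace_iso D (quotient_brace C N)"
      using D(2) by (auto simp: brace_isomorphic_def)
    then have "isoclinic n D (quotient_brace C N)"
      using isoclinic_iso[OF D(1) skew_brace_quotient[OF N]] isoclinic_class(2)[OF quot] by blast
    then show ?thesis using isoclinic_trans[OF isoclinic_trans[OF iso quot]] isoclinic_sym by blast
  qed
  from this[OF _ A] this[OF _ B] show ?thesis
    using cover prods
    unfolding common_cover_def isoclinic_to_products_def isoclinic_to_both_def by blast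
qed

lemma isoclinic_if_isoclinic_to_both: "isoclinic_to_both n A B C \<Longrightarrow> isoclinic n A B"
  unfolding isoclinic_to_both_def using isoclinic_sym isoclinic_trans by blast

theorem theoremB:
  fixes A :: "'a brace" and B :: "'b brace" and n :: nat
  assumes "n \<ge> 1" and "symmetric_skew_brace A" and "symmetric_skew_brace B"
  shows
    "(isoclinic n A B \<longleftrightarrow>
        (\<exists>(C :: ('a \<times> 'b) brace) N\<^sub>1 N\<^sub>2 C\<^sub>A C\<^sub>B. common_cover A B C N\<^sub>1 N\<^sub>2 \<and>
           isoclinic_to_both n A B C \<and> isoclinic_to_products n C N\<^sub>1 N\<^sub>2 C\<^sub>A C\<^sub>B)) \<and>
     (isoclinic n A B \<longleftrightarrow>
        (\<exists>(C :: ('a \<times> 'b) brace) N\<^sub>1 N\<^sub>2. common_cover A B C N\<^sub>1 N\<^sub>2 \<and>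
           isoclinic_to_both n A B C)) \<and>
     (isoclinic n A B \<longleftrightarrow>
        (\<exists>(C :: ('a \<times> 'b) brace) N\<^sub>1 N\<^sub>2 C\<^sub>A C\<^sub>B. common_cover A B C N\<^sub>1 N\<^sub>2 \<and>
           isoclinic_to_products n C N\<^sub>1 N\<^sub>2 C\<^sub>A C\<^sub>B)) \<and>
     (\<forall>(C :: 'c brace) N\<^sub>1 N\<^sub>2. common_cover A B C N\<^sub>1 N\<^sub>2 \<longrightarrow>
        (\<forall>C\<^sub>A C\<^sub>B. isoclinic_to_products n C N\<^sub>1 N\<^sub>2 C\<^sub>A C\<^sub>B \<longrightarrow> isoclinic_to_both n A B C) \<and>
        (isoclinic_to_both n A B C \<longrightarrow> isoclinic n A B))"
proof -
  have AB: "skew_brace A" "skew_brace B"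
    using assms(2,3) by (simp_all add: symmetric_skew_brace_def)
  have cover: "\<exists>(C :: ('a \<times> 'b) brace) N\<^sub>1 N\<^sub>2 C\<^sub>A C\<^sub>B. common_cover A B C N\<^sub>1 N\<^sub>2 \<and>
      isoclinic_to_both n A B C \<and> isoclinic_to_products n C N\<^sub>1 N\<^sub>2 C\<^sub>A C\<^sub>B" if "isoclinic n A B"
    by (rule isoclinic_common_cover[OF assms(2,3) that]) blast
  note both = products_isoclinic_to_both[OF AB] and iso = isoclinic_if_isoclinic_to_both
  show ?thesis
    by (intro conjI iffI allI impI; (elim exE conjE)?)
      ((drule cover, blast) | erule iso | erule (1) both | (rule iso, erule (1) both))+
qed

end
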